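(* Let $R$ be a commutative Noetherian ring of finite Krull dimension and let $M$ be a finitely generated binary $R$-module of valence $v$. (1) For every endomorphism $f\in\operatorname{End}_R(M)$ the following are equivalent: $f$ is nilpotent; the kernel of $f$ is an open submodule of $M$; $f^v=0$. (2) The set $\mathfrak N$ of all nilpotent endomorphisms of $M$ is a two-sided ideal of $\operatorname{End}_R(M)$, and $\mathfrak N$ is a nilpotent ideal whenever $M$ has no $\mathbb Z$-torsion. (3) The ring $\operatorname{End}_R(M)/\mathfrak N$ is commutative.
   Context: For a prime $\mathfrak p$ of $R$, $\operatorname{finlen}(M_{\mathfrak p})$ denotes the length of the largest $R_{\mathfrak p}$-submodule of finite length of $M_{\mathfrak p}$; it is nonzero exactly when $\mathfrak p\in\operatorname{Ass}(M)$. $M$ is binary if $\operatorname{finlen}(M_{\mathfrak p})=1$ for every $\mathfrak p\in\operatorname{Ass}(M)$. The (ordinal) length $\operatorname{len}(M)$ is the supremum of the order types of chains of nonzero submodules of $M$, ordered by reverse inclusion; it agrees with usual length for modules of finite length. Equivalently, by a known theorem, $\operatorname{len}(M)=\bigoplus_{\mathfrak p\in\operatorname{Ass}(M)}\operatorname{finlen}(M_{\mathfrak p})\,\omega^{\dim(R/\mathfrak p)}$, with $\bigoplus$ the natural (Hessenberg) sum of ordinals; this formula may be taken as the definition. The valence of $M$ is the sum of the coefficients of the Cantor normal form of $\operatorname{len}(M)$; for a binary module it is the number of associated primes. A submodule $N\subseteq M$ is open if $\operatorname{len}(N)=\operatorname{len}(M)$. *)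

theory Defs
  imports "HOL-Library.Extended_Nat" "HOL-Library.Multiset" "HOL-Algebra.Algebra"
begin

section \<open>Krull dimension, length and associated primes\<close>

definition fg_module :: "('a, 'r) ring_scheme \<Rightarrow> ('a, 'b, 'm) module_scheme \<Rightarrow> bool"
  where "fg_module R M \<longleftrightarrow>
    (\<exists>A \<subseteq> carrier M. finite A \<and> carrier M = \<Inter>{H. submodule H R M \<and> A \<subseteq> H})"

text \<open>With this convention the zero ring has dimension 0, since \<^term>\<open>Sup {} = (0 :: enat)\<close>.\<close>

definition krull_dim :: "('a, 'r) ring_scheme \<Rightarrow> enat"
  where "krull_dim R =
    Sup {enat n | n. \<exists>P :: nat \<Rightarrow> 'a set.
           (\<forall>i\<le>n. primeideal (P i) R) \<and> (\<forall>i<n. P i \<subset> P (Suc i))}"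

definition module_length :: "('a, 'r) ring_scheme \<Rightarrow> ('a, 'b, 'm) module_scheme \<Rightarrow> enat"
  where "module_length R M =
    Sup {enat n | n. \<exists>H :: nat \<Rightarrow> 'b set.
           (\<forall>i\<le>n. submodule (H i) R M) \<and> (\<forall>i<n. H i \<subset> H (Suc i))}"

definition Ass :: "('a, 'r) ring_scheme \<Rightarrow> ('a, 'b, 'm) module_scheme \<Rightarrow> 'a set set"
  where "Ass R M =
    {p. primeideal p R \<and>
        (\<exists>m \<in> carrier M. p = {r \<in> carrier R. r \<odot>\<^bsub>M\<^esub> m = \<zero>\<^bsub>M\<^esub>})}"


section \<open>Localization\<close>

definition loc_rel ::
    "('a, 'r) ring_scheme \<Rightarrow> ('a, 'b, 'm) module_scheme \<Rightarrow> 'a set \<Rightarrow> (('b \<times> 'a) \<times> ('b \<times> 'a)) set"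
  where "loc_rel R M S =
    {((m, s), (n, t)). m \<in> carrier M \<and> n \<in> carrier M \<and> s \<in> S \<and> t \<in> S \<and>
       (\<exists>u \<in> S. u \<odot>\<^bsub>M\<^esub> (t \<odot>\<^bsub>M\<^esub> m) = u \<odot>\<^bsub>M\<^esub> (s \<odot>\<^bsub>M\<^esub> n))}"

definition frac ::
    "('a, 'r) ring_scheme \<Rightarrow> ('a, 'b, 'm) module_scheme \<Rightarrow> 'a set \<Rightarrow> 'b \<Rightarrow> 'a \<Rightarrow> ('b \<times> 'a) set"
  where "frac R M S m s = loc_rel R M S `` {(m, s)}"

definition self_module :: "('a, 'r) ring_scheme \<Rightarrow> ('a, 'a) module"
  where "self_module R =
    \<lparr>carrier = carrier R, monoid.mult = monoid.mult R, monoid.one = \<one>\<^bsub>R\<^esub>, ring.zero = \<zero>\<^bsub>R\<^esub>,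
     ring.add = ring.add R, smult = monoid.mult R\<rparr>"

text \<open>
  The operations on fractions are defined by taking the union over all representatives of the
  class of the result, as in \<^const>\<open>rcoset_mult\<close>; all the classes in such a union coincide.
  The fields \<^const>\<open>monoid.mult\<close> and \<^const>\<open>monoid.one\<close> of a module record carry no meaning.
\<close>

definition loc_module ::
    "('a, 'r) ring_scheme \<Rightarrow> ('a, 'b, 'm) module_scheme \<Rightarrow> 'a set
       \<Rightarrow> (('a \<times> 'a) set, ('b \<times> 'a) set) module"
  where "loc_module R M S =
    \<lparr>carrier = (carrier M \<times> S) // loc_rel R M S,
     monoid.mult = undefined,
     monoid.one = undefined,
     ring.zero = frac R M S \<zero>\<^bsub>M\<^esub> \<one>\<^bsub>R\<^esub>,
     ring.add = (\<lambda>x y. \<Union>(m, s)\<in>x. \<Union>(n, t)\<in>y.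
              frac R M S ((t \<odot>\<^bsub>M\<^esub> m) \<oplus>\<^bsub>M\<^esub> (s \<odot>\<^bsub>M\<^esub> n)) (s \<otimes>\<^bsub>R\<^esub> t)),
     smult = (\<lambda>x y. \<Union>(a, s)\<in>x. \<Union>(n, t)\<in>y.
              frac R M S (a \<odot>\<^bsub>M\<^esub> n) (s \<otimes>\<^bsub>R\<^esub> t))\<rparr>"

definition loc_ring :: "('a, 'r) ring_scheme \<Rightarrow> 'a set \<Rightarrow> ('a \<times> 'a) set ring"
  where "loc_ring R S =
    \<lparr>carrier = carrier (loc_module R (self_module R) S),
     monoid.mult = smult (loc_module R (self_module R) S),
     monoid.one = frac R (self_module R) S \<one>\<^bsub>R\<^esub> \<one>\<^bsub>R\<^esub>,
     ring.zero = ring.zero (loc_module R (self_module R) S),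
     ring.add = ring.add (loc_module R (self_module R) S)\<rparr>"


section \<open>Ordinal length, valence, binary modules, open submodules\<close>

definition largest_fl_submodule ::
    "('a, 'r) ring_scheme \<Rightarrow> ('a, 'b, 'm) module_scheme \<Rightarrow> 'b set \<Rightarrow> bool"
  where "largest_fl_submodule R M H \<longleftrightarrow>
    submodule H R M \<and> module_length R (M\<lparr>carrier := H\<rparr>) < \<infinity> \<and>
    (\<forall>K. submodule K R M \<and> module_length R (M\<lparr>carrier := K\<rparr>) < \<infinity> \<longrightarrow> K \<subseteq> H)"

text \<open>
  The largest submodule of finite length exists for every Noetherian module, so that the definite
  description and \<^const>\<open>the_enat\<close> are only ever used on meaningful arguments here.
\<close>

definition finlen :: "('a, 'r) ring_scheme \<Rightarrow> ('a, 'b, 'm) module_scheme \<Rightarrow> nat"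
  where "finlen R M =
    the_enat (module_length R (M\<lparr>carrier := (THE H. largest_fl_submodule R M H)\<rparr>))"

definition finlen_at :: "('a, 'r) ring_scheme \<Rightarrow> ('a, 'b, 'm) module_scheme \<Rightarrow> 'a set \<Rightarrow> nat"
  where "finlen_at R M p =
    finlen (loc_ring R (carrier R - p)) (loc_module R M (carrier R - p))"

text \<open>
  An ordinal below \<open>\<omega>\<^sup>\<omega>\<close> is represented by the multiset of the exponents in its Cantor normal form:
  the sum of the terms \<open>c\<^sub>d * \<omega>\<^sup>d\<close> is the multiset containing every \<open>d\<close> exactly \<open>c\<^sub>d\<close> times.
  Under this representation the natural (Hessenberg) sum is the sum of multisets, the order of
  ordinals is the multiset order, and the sum of the coefficients is the size.  In particular
  \<^term>\<open>replicate_mset c d\<close> is \<open>c * \<omega>\<^sup>d\<close>.  The set of associated primes of a finitely generated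
  module over a Noetherian ring is finite, so the sum below is a genuine one.
\<close>

type_synonym omega_omega = "nat multiset"

definition len :: "('a, 'r) ring_scheme \<Rightarrow> ('a, 'b, 'm) module_scheme \<Rightarrow> omega_omega"
  where "len R M =
    (\<Sum>p \<in> Ass R M. replicate_mset (finlen_at R M p) (the_enat (krull_dim (R Quot p))))"

definition valence :: "('a, 'r) ring_scheme \<Rightarrow> ('a, 'b, 'm) module_scheme \<Rightarrow> nat"
  where "valence R M = size (len R M)"

definition binary_module :: "('a, 'r) ring_scheme \<Rightarrow> ('a, 'b, 'm) module_scheme \<Rightarrow> bool"
  where "binary_module R M \<longleftrightarrow> (\<forall>p \<in> Ass R M. finlen_at R M p = 1)"

definition open_submodule ::
    "('a, 'r) ring_scheme \<Rightarrow> ('a, 'b, 'm) module_scheme \<Rightarrow> 'b set \<Rightarrow> bool"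
  where "open_submodule R M N \<longleftrightarrow> submodule N R M \<and> len R (M\<lparr>carrier := N\<rparr>) = len R M"

definition no_int_torsion :: "('a, 'b, 'm) module_scheme \<Rightarrow> bool"
  where "no_int_torsion M \<longleftrightarrow>
    (\<forall>(n :: int) m. n \<noteq> 0 \<and> m \<in> carrier M \<and> [n] \<cdot>\<^bsub>M\<^esub> m = \<zero>\<^bsub>M\<^esub> \<longrightarrow> m = \<zero>\<^bsub>M\<^esub>)"


section \<open>Endomorphism rings and nilpotency\<close>

text \<open>Endomorphisms are extensional functions, so that equality of functions is equality on the carrier.\<close>

definition End_ring ::
    "('a, 'r) ring_scheme \<Rightarrow> ('a, 'b, 'm) module_scheme \<Rightarrow> ('b \<Rightarrow> 'b) ring"
  where "End_ring R M =
    \<lparr>carrier = {f \<in> carrier M \<rightarrow>\<^sub>E carrier M.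
        (\<forall>x \<in> carrier M. \<forall>y \<in> carrier M. f (x \<oplus>\<^bsub>M\<^esub> y) = f x \<oplus>\<^bsub>M\<^esub> f y) \<and>
        (\<forall>r \<in> carrier R. \<forall>x \<in> carrier M. f (r \<odot>\<^bsub>M\<^esub> x) = r \<odot>\<^bsub>M\<^esub> f x)},
     monoid.mult = compose (carrier M),
     monoid.one = (\<lambda>x \<in> carrier M. x),
     ring.zero = (\<lambda>x \<in> carrier M. \<zero>\<^bsub>M\<^esub>),
     ring.add = (\<lambda>f g. \<lambda>x \<in> carrier M. f x \<oplus>\<^bsub>M\<^esub> g x)\<rparr>"

definition nilpotent_elem :: "('a, 'r) ring_scheme \<Rightarrow> 'a \<Rightarrow> bool"
  where "nilpotent_elem E a \<longleftrightarrow> (\<exists>n :: nat. a [^]\<^bsub>E\<^esub> n = \<zero>\<^bsub>E\<^esub>)"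

definition nilpotents :: "('a, 'r) ring_scheme \<Rightarrow> 'a set"
  where "nilpotents E = {a \<in> carrier E. nilpotent_elem E a}"

primrec ideal_power :: "('a, 'r) ring_scheme \<Rightarrow> 'a set \<Rightarrow> nat \<Rightarrow> 'a set"
  where
    "ideal_power E I 0 = carrier E"
  | "ideal_power E I (Suc n) = ideal_prod E (ideal_power E I n) I"

definition nilpotent_ideal :: "('a, 'r) ring_scheme \<Rightarrow> 'a set \<Rightarrow> bool"
  where "nilpotent_ideal E I \<longleftrightarrow> ideal I E \<and> (\<exists>n. ideal_power E I n = {\<zero>\<^bsub>E\<^esub>})"

end

theory Submission
  imports Defs
begin

text \<open>
  For an associated prime \<open>p\<close> let \<open>T\<^sub>p\<close> be the preimage in \<open>M\<close> of the largest submodule of finite length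
  of \<open>M\<^sub>p\<close>, which consists of the \<open>p\<close>-power torsion elements.  If this submodule has length one, then
  every endomorphism acts on it by a scalar of the residue field.  So \<open>f \<mapsto>\<close> (its scalar at every \<open>p\<close>) is a
  homomorphism from the endomorphism ring to a product of fields; its kernel \<open>K\<close> is a two-sided ideal that
  contains all commutators and all nilpotents, and \<open>f\<close> lies in \<open>K\<close> iff its kernel has the same associated
  primes as \<open>M\<close>, that is, iff its kernel is open.

  Conversely let \<open>f \<in> K\<close> and \<open>N \<noteq> 0\<close> a submodule.  A minimal element \<open>q\<close> of \<open>Ass M \<inter> Supp N\<close> is minimal
  in \<open>Supp N\<close>, so \<open>N \<subseteq> T\<^sub>q\<close> and \<open>q\<close> is not in the support of \<open>f N\<close>.  Hence the product of any \<open>v\<close>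
  elements of \<open>K\<close> is zero, where \<open>v\<close> is the number of associated primes.
\<close>

section \<open>Noetherian modules and associated primes\<close>

text \<open>No endomorphism is ever localized. The scalar of \<open>f\<close> at
  \<open>p = ann m\<close> appears as a fraction \<open>r / s\<close> with
  \<open>s f(m) = r m\<close> and \<open>s\<close> outside \<open>p\<close>, and statements about
  \<open>M_p\<close> become statements about elements of \<open>M\<close> up to multiplication by
  such denominators. The localized module itself has to be handled only for the hypothesis:
  \<open>finlen_at\<close> is defined by chains in \<open>M_p\<close>, and these are carried to
  chains of saturated submodules of \<open>M\<close>, where they can be counted. Proving that
  \<open>T_p\<close> has finite length is part of this work, since only then does the definite
  description in \<open>finlen\<close> denote its image in \<open>M_p\<close>. The scalar exists
  because a module of length one over the local ring \<open>R_p\<close> is a copy of the residue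
  field. Openness turns into a statement about associated primes because in a binary module each of
  them contributes a single term to the length: a submodule has no associated primes other than
  those of \<open>M\<close>, so its length is the same only if none of them is lost.\<close>

definition ann :: "('a, 'r) ring_scheme \<Rightarrow> ('a, 'b, 'm) module_scheme \<Rightarrow> 'b \<Rightarrow> 'a set"
  where "ann R M x = {r \<in> carrier R. r \<odot>\<^bsub>M\<^esub> x = \<zero>\<^bsub>M\<^esub>}"

text \<open>The exponent \<open>n\<close> and the denominator \<open>s\<close> may depend on
  \<open>a\<close>, so that no powers of the ideal \<open>p\<close> have to be formed. Over a
  Noetherian ring this agrees with being killed by a power of \<open>p\<close> after localization,
  because \<open>p\<close> is finitely generated.\<close>

definition loc_tors :: "('a, 'r) ring_scheme \<Rightarrow> ('a, 'b, 'm) module_scheme \<Rightarrow> 'a set \<Rightarrow> 'b set"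
  where "loc_tors R M p = {x \<in> carrier M. \<forall>a\<in>p. \<exists>n::nat. \<exists>s\<in>carrier R - p.
           s \<odot>\<^bsub>M\<^esub> (a [^]\<^bsub>R\<^esub> n \<odot>\<^bsub>M\<^esub> x) = \<zero>\<^bsub>M\<^esub>}"

lemma Ass_eq: "Ass R M = {p. primeideal p R \<and> (\<exists>m\<in>carrier M. ann R M m = p)}"
  unfolding Ass_def ann_def by auto

text \<open>The ascending chain condition as well-foundedness: larger ideals count as smaller, so a
  minimal element of a set of ideals is one that is maximal for inclusion. The union of a strictly
  ascending sequence would have to be one of its members, by
  \<open>ideal_chain_is_trivial\<close>.\<close>

lemma (in noetherian_ring) wf_ideals:
  "wf {(J, I). ideal I R \<and> ideal J R \<and> I \<subset> J}"
  unfolding wf_iff_no_infinite_down_chain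
proof
  assume "\<exists>f. \<forall>i. (f (Suc i), f i) \<in> {(J, I). ideal I R \<and> ideal J R \<and> I \<subset> J}"
  then obtain f where "\<forall>i. (f (Suc i), f i) \<in> {(J, I). ideal I R \<and> ideal J R \<and> I \<subset> J}" by (elim exE)
  then have f: "\<And>i. ideal (f i) R" "\<And>i. f i \<subset> f (Suc i)" by auto
  have mono: "i \<le> j \<Longrightarrow> f i \<subseteq> f j" for i j
    using lift_Suc_mono_le[of f i j] f(2) by blast
  have "\<Union>(range f) \<in> range f"
  proof (rule ideal_chain_is_trivial)
    show "subset.chain {I. ideal I R} (range f)"
      unfolding subset_chain_def using f(1) mono nat_le_linear by blast
  qed auto
  then obtain i where "\<Union>(range f) = f i" by auto
  then have "f (Suc i) \<subseteq> f i" by blast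
  then show False using f(2)[of i] by blast
qed

section \<open>Submodules, colon ideals and the ascending chain condition\<close>

context module
begin

lemma smult_commute:
  "\<lbrakk>a \<in> carrier R; b \<in> carrier R; x \<in> carrier M\<rbrakk> \<Longrightarrow> a \<odot>\<^bsub>M\<^esub> (b \<odot>\<^bsub>M\<^esub> x) = b \<odot>\<^bsub>M\<^esub> (a \<odot>\<^bsub>M\<^esub> x)"
  by (metis R.m_comm smult_assoc1)

lemma submodule_zero: "submodule H R M \<Longrightarrow> \<zero>\<^bsub>M\<^esub> \<in> H"
  using subgroup.one_closed[OF submodule.axioms(1)] by fastforce

lemma submodule_minus: "\<lbrakk>submodule H R M; x \<in> H; y \<in> H\<rbrakk> \<Longrightarrow> x \<ominus>\<^bsub>M\<^esub> y \<in> H"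
  by (simp add: a_minus_def submoduleE(3,5))

lemma submodule_Inter:
  assumes "\<And>H. H \<in> F \<Longrightarrow> submodule H R M" and "F \<noteq> {}"
  shows "submodule (\<Inter>F) R M"
  using assms by (intro submoduleI) (auto dest: submoduleE submodule_zero)

lemma submodule_Int:
  "\<lbrakk>submodule H R M; submodule K R M\<rbrakk> \<Longrightarrow> submodule (H \<inter> K) R M"
  using submodule_Inter[of "{H, K}"] by auto

lemma submodule_adjoin:
  assumes H: "submodule H R M" and x: "x \<in> carrier M"
  shows "submodule {h \<oplus>\<^bsub>M\<^esub> r \<odot>\<^bsub>M\<^esub> x | h r. h \<in> H \<and> r \<in> carrier R} R M" (is "submodule ?S R M")
proof (rule submoduleI)
  note Hc = subsetD[OF submoduleE(1)[OF H]]
  show "?S \<subseteq> carrier M" using Hc x by auto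
  show "\<zero>\<^bsub>M\<^esub> \<in> ?S" using submodule_zero[OF H] x
    by (intro CollectI exI[of _ "\<zero>\<^bsub>M\<^esub>"] exI[of _ "\<zero>"]) auto
  fix a assume "a \<in> ?S"
  then obtain h r where a: "a = h \<oplus>\<^bsub>M\<^esub> r \<odot>\<^bsub>M\<^esub> x" "h \<in> H" "r \<in> carrier R" by blast
  show "\<ominus>\<^bsub>M\<^esub> a \<in> ?S" using a x Hc submoduleE(3)[OF H]
    by (intro CollectI exI[of _ "\<ominus>\<^bsub>M\<^esub> h"] exI[of _ "\<ominus> r"]) (auto simp: M.minus_add smult_l_minus)
  { fix b assume "b \<in> ?S"
    then obtain h' r' where b: "b = h' \<oplus>\<^bsub>M\<^esub> r' \<odot>\<^bsub>M\<^esub> x" "h' \<in> H" "r' \<in> carrier R" by blast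
    show "a \<oplus>\<^bsub>M\<^esub> b \<in> ?S" using a b x Hc submoduleE(5)[OF H]
      by (intro CollectI exI[of _ "h \<oplus>\<^bsub>M\<^esub> h'"] exI[of _ "r \<oplus> r'"]) (auto simp: smult_l_distr M.a_ac) }
  { fix c assume "c \<in> carrier R"
    then show "c \<odot>\<^bsub>M\<^esub> a \<in> ?S" using a x Hc submoduleE(4)[OF H]
      by (intro CollectI exI[of _ "c \<odot>\<^bsub>M\<^esub> h"] exI[of _ "c \<otimes> r"]) (auto simp: smult_r_distr smult_assoc1) }
qed

lemma ideal_colon:
  assumes N: "submodule N R M" and x: "x \<in> carrier M"
  shows "ideal {r \<in> carrier R. r \<odot>\<^bsub>M\<^esub> x \<in> N} R"
proof (rule idealI)
  show "ring R" by (rule R.ring_axioms)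
  show "subgroup {r \<in> carrier R. r \<odot>\<^bsub>M\<^esub> x \<in> N} (add_monoid R)"
    using x submodule_zero[OF N] submoduleE(3,5)[OF N] by (intro R.add.subgroupI)
      (auto simp: smult_l_distr smult_l_minus a_inv_def[symmetric] intro: exI[of _ "\<zero>"])
  fix a r assume "a \<in> {r \<in> carrier R. r \<odot>\<^bsub>M\<^esub> x \<in> N}" "r \<in> carrier R"
  then show "r \<otimes> a \<in> {r \<in> carrier R. r \<odot>\<^bsub>M\<^esub> x \<in> N}" "a \<otimes> r \<in> {r \<in> carrier R. r \<odot>\<^bsub>M\<^esub> x \<in> N}"
    using x R.m_comm[of a r] submoduleE(4)[OF N] by (auto simp: smult_assoc1)
qed

lemma submodule_zero_set: "submodule {\<zero>\<^bsub>M\<^esub>} R M"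
  by (rule submoduleI) auto

lemma ideal_ann: "x \<in> carrier M \<Longrightarrow> ideal (ann R M x) R"
  using ideal_colon[OF submodule_zero_set, of x] by (simp add: ann_def)

text \<open>Induction on the generators. Inside the span of \<open>A\<close> and \<open>x\<close>, a
  submodule \<open>H\<close> has two invariants: its intersection with the span of \<open>A\<close>,
  and the ideal \<open>I H\<close> of the coefficients of \<open>x\<close> that occur in
  \<open>H\<close>. Both grow weakly with \<open>H\<close>, and nested submodules with the same
  invariants coincide, so a strict inclusion is a strict step in the lexicographic product.\<close>

lemma wf_submodules_span:
  assumes "noetherian_ring R" and "finite A" and "A \<subseteq> carrier M"
  shows "wf {(K, H). submodule H R M \<and> submodule K R M \<and> H \<subset> K \<and>
             K \<subseteq> \<Inter>{L. submodule L R M \<and> A \<subseteq> L}}"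
  using assms(2,3)
proof (induction A)
  case empty
  have "{(K, H). submodule H R M \<and> submodule K R M \<and> H \<subset> K \<and>
             K \<subseteq> \<Inter>{L. submodule L R M \<and> {} \<subseteq> L}} = {}"
    using submodule_zero submodule_zero_set by fast
  then show ?case by (rule ssubst) simp
next
  case (insert x A)
  let ?sp = "\<lambda>A. \<Inter>{L. submodule L R M \<and> A \<subseteq> L}"
  have x: "x \<in> carrier M" and A: "A \<subseteq> carrier M" using insert.prems by auto
  have sp: "submodule (?sp A) R M"
    using carrier_is_submodule A by (intro submodule_Inter) auto
  note spc = subsetD[OF submoduleE(1)[OF sp]]
  define I where "I = (\<lambda>H. {r \<in> carrier R. \<exists>n\<in>?sp A. n \<oplus>\<^bsub>M\<^esub> r \<odot>\<^bsub>M\<^esub> x \<in> H})"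
  have memI: "r \<in> I H" if "r \<in> carrier R" "n \<in> ?sp A" "n \<oplus>\<^bsub>M\<^esub> r \<odot>\<^bsub>M\<^esub> x \<in> H" for r n H
    unfolding I_def using that by blast
  have sub: "?sp (insert x A) \<subseteq> {h \<oplus>\<^bsub>M\<^esub> r \<odot>\<^bsub>M\<^esub> x | h r. h \<in> ?sp A \<and> r \<in> carrier R}" (is "_ \<subseteq> ?S")
  proof -
    have "submodule ?S R M" by (rule submodule_adjoin[OF sp x])
    moreover have "x \<in> ?S"
      using x submodule_zero[OF sp] by (intro CollectI exI[of _ "\<zero>\<^bsub>M\<^esub>"] exI[of _ "\<one>"]) auto
    moreover have "A \<subseteq> ?S"
    proof
      fix a assume "a \<in> A"
      then show "a \<in> ?S" using x A
        by (intro CollectI exI[of _ a] exI[of _ "\<zero>"]) auto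
    qed
    ultimately show ?thesis by (intro Inter_lower) auto
  qed
  have I: "ideal (I H) R" if H: "submodule H R M" for H
  proof (rule idealI)
    note Hc = subsetD[OF submoduleE(1)[OF H]]
    show "ring R" by (rule R.ring_axioms)
    show "subgroup (I H) (add_monoid R)"
    proof (rule R.add.subgroupI)
      show "I H \<subseteq> carrier R" by (auto simp: I_def)
      have "\<zero> \<in> I H" using submodule_zero[OF sp] submodule_zero[OF H] x
        by (auto simp: I_def intro!: bexI[of _ "\<zero>\<^bsub>M\<^esub>"])
      then show "I H \<noteq> {}" by auto
      fix a assume "a \<in> I H"
      then obtain n where a: "a \<in> carrier R" "n \<in> ?sp A" "n \<oplus>\<^bsub>M\<^esub> a \<odot>\<^bsub>M\<^esub> x \<in> H" by (auto simp: I_def)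
      have "\<ominus>\<^bsub>M\<^esub> n \<oplus>\<^bsub>M\<^esub> (\<ominus> a) \<odot>\<^bsub>M\<^esub> x = \<ominus>\<^bsub>M\<^esub> (n \<oplus>\<^bsub>M\<^esub> a \<odot>\<^bsub>M\<^esub> x)"
        using a x spc[OF a(2)] by (simp add: M.minus_add smult_l_minus)
      then show "\<ominus> a \<in> I H"
        using a submoduleE(3)[OF sp a(2)] submoduleE(3)[OF H a(3)]
        by (intro memI[of _ "\<ominus>\<^bsub>M\<^esub> n"]) auto
      fix b assume "b \<in> I H"
      then obtain n' where b: "b \<in> carrier R" "n' \<in> ?sp A" "n' \<oplus>\<^bsub>M\<^esub> b \<odot>\<^bsub>M\<^esub> x \<in> H" by (auto simp: I_def)
      have "(n \<oplus>\<^bsub>M\<^esub> n') \<oplus>\<^bsub>M\<^esub> (a \<oplus> b) \<odot>\<^bsub>M\<^esub> x = (n \<oplus>\<^bsub>M\<^esub> a \<odot>\<^bsub>M\<^esub> x) \<oplus>\<^bsub>M\<^esub> (n' \<oplus>\<^bsub>M\<^esub> b \<odot>\<^bsub>M\<^esub> x)"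
        using a b x spc[OF a(2)] spc[OF b(2)] by (simp add: smult_l_distr M.a_ac)
      then show "a \<oplus> b \<in> I H"
        using a b submoduleE(5)[OF sp a(2) b(2)] submoduleE(5)[OF H a(3) b(3)]
        by (intro memI[of _ "n \<oplus>\<^bsub>M\<^esub> n'"]) auto
    qed
    fix a c assume ac: "a \<in> I H" "c \<in> carrier R"
    then obtain n where a: "a \<in> carrier R" "n \<in> ?sp A" "n \<oplus>\<^bsub>M\<^esub> a \<odot>\<^bsub>M\<^esub> x \<in> H" by (auto simp: I_def)
    have "c \<odot>\<^bsub>M\<^esub> n \<oplus>\<^bsub>M\<^esub> (c \<otimes> a) \<odot>\<^bsub>M\<^esub> x = c \<odot>\<^bsub>M\<^esub> (n \<oplus>\<^bsub>M\<^esub> a \<odot>\<^bsub>M\<^esub> x)"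
      using a x ac spc[OF a(2)] by (simp add: smult_r_distr smult_assoc1)
    then show "c \<otimes> a \<in> I H"
      using a submoduleE(4)[OF sp ac(2) a(2)] submoduleE(4)[OF H ac(2) a(3)] ac
      by (intro memI[of _ "c \<odot>\<^bsub>M\<^esub> n"]) auto
    then show "a \<otimes> c \<in> I H" using a ac by (simp add: R.m_comm)
  qed
  let ?r1 = "{(K, H). submodule H R M \<and> submodule K R M \<and> H \<subset> K \<and> K \<subseteq> ?sp A}"
  let ?r2 = "{(J, I). ideal I R \<and> ideal J R \<and> I \<subset> J}"
  have "wf (inv_image (?r1 <*lex*> ?r2) (\<lambda>H. (H \<inter> ?sp A, I H)))"
    using insert.IH[OF A] noetherian_ring.wf_ideals[OF assms(1)] by (intro wf_inv_image wf_lex_prod)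
  then show ?case
  proof (rule wf_subset, intro subrelI, unfold mem_Collect_eq case_prod_conv, elim conjE)
    fix K H assume H: "submodule H R M" and K: "submodule K R M" and HK: "H \<subset> K"
      and Ks: "K \<subseteq> ?sp (insert x A)"
    note Kc = subsetD[OF submoduleE(1)[OF K]]
    have mono: "H \<inter> ?sp A \<subseteq> K \<inter> ?sp A" "I H \<subseteq> I K" using HK by (auto simp: I_def)
    have "I H \<noteq> I K" if eq: "H \<inter> ?sp A = K \<inter> ?sp A"
    proof
      assume eq2: "I H = I K"
      have "K \<subseteq> H"
      proof
        fix z assume z: "z \<in> K"
        then obtain n r where nr: "z = n \<oplus>\<^bsub>M\<^esub> r \<odot>\<^bsub>M\<^esub> x" "n \<in> ?sp A" "r \<in> carrier R"
          using Ks sub by blast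
        then have "r \<in> I H" unfolding eq2 using z by (intro memI[of _ n]) auto
        then obtain n' where n': "n' \<in> ?sp A" "n' \<oplus>\<^bsub>M\<^esub> r \<odot>\<^bsub>M\<^esub> x \<in> H" unfolding I_def by blast
        \<comment> \<open>Subtracting the element of \<open>H\<close> with the same coefficient of
          \<open>x\<close> leaves an element of the span of \<open>A\<close>, where \<open>H\<close>
          and \<open>K\<close> agree.\<close>
        have "z \<ominus>\<^bsub>M\<^esub> (n' \<oplus>\<^bsub>M\<^esub> r \<odot>\<^bsub>M\<^esub> x) = n \<ominus>\<^bsub>M\<^esub> n'"
          using nr x spc[OF n'(1)] spc[OF nr(2)]
          by (simp add: a_minus_def M.minus_add M.a_ac M.r_neg M.r_neg1 M.r_neg2)
        then have "n \<ominus>\<^bsub>M\<^esub> n' \<in> K"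
          using submodule_minus[OF K z, of "n' \<oplus>\<^bsub>M\<^esub> r \<odot>\<^bsub>M\<^esub> x"] n'(2) HK by auto
        moreover have "n \<ominus>\<^bsub>M\<^esub> n' \<in> ?sp A" by (rule submodule_minus[OF sp nr(2) n'(1)])
        ultimately have "n \<ominus>\<^bsub>M\<^esub> n' \<in> H" using eq by blast
        then have "(n \<ominus>\<^bsub>M\<^esub> n') \<oplus>\<^bsub>M\<^esub> (n' \<oplus>\<^bsub>M\<^esub> r \<odot>\<^bsub>M\<^esub> x) \<in> H" using submoduleE(5)[OF H _ n'(2)] by blast
        also have "(n \<ominus>\<^bsub>M\<^esub> n') \<oplus>\<^bsub>M\<^esub> (n' \<oplus>\<^bsub>M\<^esub> r \<odot>\<^bsub>M\<^esub> x) = z"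
          using nr x spc[OF n'(1)] spc[OF nr(2)]
          by (simp add: a_minus_def M.a_assoc M.r_neg1)
        finally show "z \<in> H" .
      qed
      with HK show False by blast
    qed
    then show "(K, H) \<in> inv_image (?r1 <*lex*> ?r2) (\<lambda>H. (H \<inter> ?sp A, I H))"
      unfolding in_inv_image in_lex_prod mem_Collect_eq case_prod_conv psubset_eq
      using mono submodule_Int[OF H sp] submodule_Int[OF K sp] I[OF H] I[OF K]
      by (cases "H \<inter> ?sp A = K \<inter> ?sp A") (simp_all del: Int_iff Inter_iff le_Inf_iff le_inf_iff)
  qed
qed

end

lemma wf_minimal:
  assumes "wf r" and "x \<in> Q"
  shows "\<exists>z. z \<in> Q \<and> (\<forall>y. (y, z) \<in> r \<longrightarrow> y \<notin> Q)"
  using wfE_min[OF assms] by blast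

text \<open>Based on the chain condition and not on finite generation, because the chain condition
  passes to submodules at once; kernels of endomorphisms are later treated as modules of this
  kind.\<close>

locale noetherian_module = module +
  assumes noetherian_ring: "noetherian_ring R"
    and wf_submodules: "wf {(K, H). submodule H R M \<and> submodule K R M \<and> H \<subset> K}"

lemma (in module) fg_noetherian_module:
  assumes "noetherian_ring R" and "fg_module R M"
  shows "noetherian_module R M"
proof (intro noetherian_module.intro noetherian_module_axioms.intro)
  obtain A where A: "A \<subseteq> carrier M" "finite A" "carrier M = \<Inter>{H. submodule H R M \<and> A \<subseteq> H}"
    using assms(2) unfolding fg_module_def by auto
  show "wf {(K, H). submodule H R M \<and> submodule K R M \<and> H \<subset> K}"
  proof (rule wf_subset[OF wf_submodules_span[OF assms(1) A(2,1)]])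
    show "{(K, H). submodule H R M \<and> submodule K R M \<and> H \<subset> K}
      \<subseteq> {(K, H). submodule H R M \<and> submodule K R M \<and> H \<subset> K \<and>
          K \<subseteq> \<Inter>{L. submodule L R M \<and> A \<subseteq> L}}"
      unfolding A(3)[symmetric] using submoduleE(1) by blast
  qed
qed (use assms module_axioms in auto)

section \<open>Annihilators and associated primes\<close>

context module
begin

lemma ann_iff: "r \<in> ann R M x \<longleftrightarrow> r \<in> carrier R \<and> r \<odot>\<^bsub>M\<^esub> x = \<zero>\<^bsub>M\<^esub>"
  by (simp add: ann_def)

lemma ann_smult_mono:
  "\<lbrakk>r \<in> carrier R; x \<in> carrier M\<rbrakk> \<Longrightarrow> ann R M x \<subseteq> ann R M (r \<odot>\<^bsub>M\<^esub> x)"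
  by (auto simp: ann_def smult_commute[of _ r])

text \<open>Allows a witness of an associated prime to be multiplied by a denominator outside the
  prime and to remain a witness.\<close>

lemma ann_smult_prime:
  assumes "primeideal (ann R M x) R" "s \<in> carrier R" "s \<notin> ann R M x" "x \<in> carrier M"
  shows "ann R M (s \<odot>\<^bsub>M\<^esub> x) = ann R M x"
proof
  show "ann R M (s \<odot>\<^bsub>M\<^esub> x) \<subseteq> ann R M x"
  proof
    fix r assume "r \<in> ann R M (s \<odot>\<^bsub>M\<^esub> x)"
    then have "r \<in> carrier R" "r \<otimes> s \<in> ann R M x" using assms by (auto simp: ann_iff smult_assoc1)
    then show "r \<in> ann R M x" using primeideal.I_prime[OF assms(1)] assms by blast
  qed
qed (rule ann_smult_mono[OF assms(2,4)])

end

context noetherian_module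
begin

text \<open>Among the annihilators of multiples of \<open>x\<close> that miss \<open>T\<close>, a
  maximal one, \<open>ann y\<close>, is prime. Let \<open>b c\<close> kill \<open>y\<close>. If
  \<open>ann (b y)\<close> misses \<open>T\<close>, it equals \<open>ann y\<close> by maximality,
  and it contains \<open>c\<close>. Otherwise some \<open>t\<close> in \<open>T\<close> kills
  \<open>b y\<close>; then \<open>ann (t y)\<close> still misses \<open>T\<close>, as
  \<open>T\<close> is closed under products, so it equals \<open>ann y\<close>, and it contains
  \<open>b\<close>.\<close>

lemma exists_prime_ann:
  assumes x: "x \<in> carrier M" and T: "T \<subseteq> carrier R" "\<one> \<in> T" "\<And>s t. \<lbrakk>s \<in> T; t \<in> T\<rbrakk> \<Longrightarrow> s \<otimes> t \<in> T"
    and disj: "ann R M x \<inter> T = {}"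
  obtains r where "r \<in> carrier R" "primeideal (ann R M (r \<odot>\<^bsub>M\<^esub> x)) R" "ann R M (r \<odot>\<^bsub>M\<^esub> x) \<inter> T = {}"
proof -
  let ?a = "ann R M"
  let ?Q = "{?a (r \<odot>\<^bsub>M\<^esub> x) | r. r \<in> carrier R \<and> ?a (r \<odot>\<^bsub>M\<^esub> x) \<inter> T = {}}"
  have "?a (\<one> \<odot>\<^bsub>M\<^esub> x) \<in> ?Q" using disj x by (intro CollectI exI[of _ \<one>]) simp
  from wf_minimal[OF noetherian_ring.wf_ideals[OF noetherian_ring] this]
  obtain Z where Z': "Z \<in> ?Q"
    "\<forall>J. (J, Z) \<in> {(J, I). ideal I R \<and> ideal J R \<and> I \<subset> J} \<longrightarrow> J \<notin> ?Q" by (elim exE conjE)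
  note Z = Z'(1) Z'(2)[rule_format]
  from Z obtain r where r: "r \<in> carrier R" "Z = ?a (r \<odot>\<^bsub>M\<^esub> x)" "Z \<inter> T = {}" by auto
  define y where "y = r \<odot>\<^bsub>M\<^esub> x"
  have y: "y \<in> carrier M" using r x by (simp add: y_def)
  have max: "?a (s \<odot>\<^bsub>M\<^esub> y) = ?a y" if s: "s \<in> carrier R" and d: "?a (s \<odot>\<^bsub>M\<^esub> y) \<inter> T = {}" for s
  proof (rule ccontr)
    assume "?a (s \<odot>\<^bsub>M\<^esub> y) \<noteq> ?a y"
    then have "?a y \<subset> ?a (s \<odot>\<^bsub>M\<^esub> y)" using ann_smult_mono[OF s y] by blast
    then have "?a (s \<odot>\<^bsub>M\<^esub> y) \<notin> ?Q"
      using Z(2)[of "?a (s \<odot>\<^bsub>M\<^esub> y)"] ideal_ann[of y] ideal_ann[of "s \<odot>\<^bsub>M\<^esub> y"] s y r(2)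
      unfolding y_def by blast
    moreover have "?a (s \<odot>\<^bsub>M\<^esub> y) \<in> ?Q"
      using s d r x by (intro CollectI exI[of _ "s \<otimes> r"]) (auto simp: y_def smult_assoc1)
    ultimately show False by blast
  qed
  have "primeideal (?a y) R"
  proof (rule primeidealI)
    show "ideal (?a y) R" by (rule ideal_ann[OF y])
    show "cring R" by (rule R.cring_axioms)
    show "carrier R \<noteq> ?a y" using r T by (auto simp: y_def)
    fix b c assume bc: "b \<in> carrier R" "c \<in> carrier R" "b \<otimes> c \<in> ?a y"
    show "b \<in> ?a y \<or> c \<in> ?a y"
    proof (cases "?a (b \<odot>\<^bsub>M\<^esub> y) \<inter> T = {}")
      case True
      have "c \<in> ?a (b \<odot>\<^bsub>M\<^esub> y)" using bc y by (auto simp: ann_iff smult_assoc1 smult_commute[of c b])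
      then show ?thesis using max[OF bc(1) True] by simp
    next
      case False
      then obtain t where t: "t \<in> T" "t \<odot>\<^bsub>M\<^esub> (b \<odot>\<^bsub>M\<^esub> y) = \<zero>\<^bsub>M\<^esub>" by (auto simp: ann_iff)
      have tR: "t \<in> carrier R" using t T by auto
      have "?a (t \<odot>\<^bsub>M\<^esub> y) \<inter> T = {}"
      proof (rule ccontr)
        assume "?a (t \<odot>\<^bsub>M\<^esub> y) \<inter> T \<noteq> {}"
        then obtain u where "u \<in> T" "u \<odot>\<^bsub>M\<^esub> (t \<odot>\<^bsub>M\<^esub> y) = \<zero>\<^bsub>M\<^esub>" by (auto simp: ann_iff)
        then have "u \<otimes> t \<in> ?a y \<inter> T" using t tR T y by (auto simp: ann_iff smult_assoc1)
        then show False using r by (auto simp: y_def)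
      qed
      then have "?a (t \<odot>\<^bsub>M\<^esub> y) = ?a y" using max[OF tR] by simp
      moreover have "b \<in> ?a (t \<odot>\<^bsub>M\<^esub> y)" using t bc tR y by (auto simp: ann_iff smult_commute[of b t])
      ultimately show ?thesis by simp
    qed
  qed
  then show ?thesis using that r by (simp add: y_def)
qed

lemma exists_prime_ann_nonzero:
  assumes "x \<in> carrier M" "x \<noteq> \<zero>\<^bsub>M\<^esub>"
  obtains r where "r \<in> carrier R" "primeideal (ann R M (r \<odot>\<^bsub>M\<^esub> x)) R"
  using exists_prime_ann[of x "{\<one>}"] assms by (auto simp: ann_iff)

text \<open>Let \<open>N\<close> be maximal among the submodules whose elements have only finitely
  many prime annihilators. If \<open>N\<close> is not everything, choose \<open>x\<close> outside
  \<open>N\<close> with \<open>(N : x)\<close> maximal. This ideal behaves like a prime, and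
  adjoining \<open>x\<close> to \<open>N\<close> adds at most this one prime to the list.\<close>

lemma finite_Ass: "finite (Ass R M)"
proof -
  define A where "A = (\<lambda>N. {p. primeideal p R \<and> (\<exists>m\<in>N. ann R M m = p)})"
  let ?Q = "{N. submodule N R M \<and> finite (A N)}"
  have "A {\<zero>\<^bsub>M\<^esub>} \<subseteq> {ann R M \<zero>\<^bsub>M\<^esub>}" by (auto simp: A_def)
  then have "{\<zero>\<^bsub>M\<^esub>} \<in> ?Q" using submodule_zero_set finite_subset by auto
  from wf_minimal[OF wf_submodules this]
  obtain N where N': "N \<in> ?Q"
    "\<forall>K. (K, N) \<in> {(K, H). submodule H R M \<and> submodule K R M \<and> H \<subset> K} \<longrightarrow> K \<notin> ?Q" by (elim exE conjE)
  note N = N'(1) N'(2)[rule_format]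
  have Ns: "submodule N R M" and fin: "finite (A N)" using N by auto
  note Nc = subsetD[OF submoduleE(1)[OF Ns]]
  have "carrier M \<subseteq> N"
  proof (rule ccontr)
    assume "\<not> carrier M \<subseteq> N"
    then obtain x0 where x0: "x0 \<in> carrier M" "x0 \<notin> N" by auto
    define C where "C = (\<lambda>x. {r \<in> carrier R. r \<odot>\<^bsub>M\<^esub> x \<in> N})"
    have idC: "ideal (C x) R" if "x \<in> carrier M" for x
      unfolding C_def by (rule ideal_colon[OF Ns that])
    have "C x0 \<in> {C x | x. x \<in> carrier M - N}" using x0 by blast
    from wf_minimal[OF noetherian_ring.wf_ideals[OF noetherian_ring] this]
    obtain P where P': "P \<in> {C x | x. x \<in> carrier M - N}"
    "\<forall>J. (J, P) \<in> {(J, I). ideal I R \<and> ideal J R \<and> I \<subset> J} \<longrightarrow> J \<notin> {C x | x. x \<in> carrier M - N}" by (elim exE conjE)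
    note P = P'(1) P'(2)[rule_format]
    from P obtain x where x: "x \<in> carrier M" "x \<notin> N" "P = C x" by auto
    let ?K = "{h \<oplus>\<^bsub>M\<^esub> r \<odot>\<^bsub>M\<^esub> x | h r. h \<in> N \<and> r \<in> carrier R}"
    have K: "submodule ?K R M" by (rule submodule_adjoin[OF Ns x(1)])
    \<comment> \<open>Replacing \<open>x\<close> by \<open>b x\<close>, which still lies outside
      \<open>N\<close>, cannot enlarge the colon ideal, by its maximality.\<close>
    have prime: "c \<in> C x" if "b \<in> carrier R" "c \<in> carrier R" "b \<otimes> c \<in> C x" "b \<notin> C x" for b c
    proof -
      have bx: "b \<odot>\<^bsub>M\<^esub> x \<in> carrier M - N" using that x by (auto simp: C_def)
      have "C x \<subseteq> C (b \<odot>\<^bsub>M\<^esub> x)" 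
        using that x submoduleE(4)[OF Ns] by (auto simp: C_def smult_commute[of _ b])
      then have "C x = C (b \<odot>\<^bsub>M\<^esub> x)"
        using P(2)[of "C (b \<odot>\<^bsub>M\<^esub> x)"] x bx idC by blast
      moreover have "c \<in> C (b \<odot>\<^bsub>M\<^esub> x)" using that x by (auto simp: C_def smult_assoc1 smult_commute[of c b])
      ultimately show ?thesis by simp
    qed
    have "A ?K \<subseteq> insert P (A N)"
    proof
      fix q assume "q \<in> A ?K"
      then obtain n r where q: "primeideal q R" "n \<in> N" "r \<in> carrier R" "q = ann R M (n \<oplus>\<^bsub>M\<^esub> r \<odot>\<^bsub>M\<^esub> x)"
        by (auto simp: A_def)
      let ?z = "n \<oplus>\<^bsub>M\<^esub> r \<odot>\<^bsub>M\<^esub> x"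
      have z: "?z \<in> carrier M" using q x Nc by auto
      show "q \<in> insert P (A N)"
      proof (cases "r \<in> C x")
        case True
        then have "?z \<in> N" using q submoduleE(5)[OF Ns] by (auto simp: C_def)
        then show ?thesis using q by (auto simp: A_def)
      next
        case False
        \<comment> \<open>If \<open>a\<close> kills \<open>n + r x\<close>, then
          \<open>(r a) x\<close> lies in \<open>N\<close>; as \<open>r\<close> is not in
          \<open>P\<close>, the prime property leaves only \<open>a\<close> in
          \<open>P\<close>.\<close>
        have sub: "q \<subseteq> P"
        proof
          fix a assume "a \<in> q"
          then have a: "a \<in> carrier R" "a \<odot>\<^bsub>M\<^esub> ?z = \<zero>\<^bsub>M\<^esub>" using q by (auto simp: ann_iff)
          then have "a \<odot>\<^bsub>M\<^esub> n \<oplus>\<^bsub>M\<^esub> (r \<otimes> a) \<odot>\<^bsub>M\<^esub> x = \<zero>\<^bsub>M\<^esub>"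
            using q x Nc by (simp add: smult_r_distr smult_assoc1 smult_commute[of a r])
          then have "(r \<otimes> a) \<odot>\<^bsub>M\<^esub> x = \<ominus>\<^bsub>M\<^esub> (a \<odot>\<^bsub>M\<^esub> n)"
            using M.minus_equality[of "(r \<otimes> a) \<odot>\<^bsub>M\<^esub> x" "a \<odot>\<^bsub>M\<^esub> n"] q x Nc a by (simp add: M.a_comm)
          then have "r \<otimes> a \<in> C x" using q a submoduleE(3,4)[OF Ns] by (auto simp: C_def)
          then show "a \<in> P" using prime[OF q(3) a(1)] False x by blast
        qed
        show ?thesis
        proof (cases "q = P")
          case False
          \<comment> \<open>Multiplying \<open>?z\<close> by \<open>a\<close> moves it into
            \<open>N\<close> and, since \<open>a\<close> is outside the prime \<open>q\<close>,
            keeps its annihilator.\<close>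
          then obtain a where a: "a \<in> P" "a \<notin> q" using sub by auto
          then have aR: "a \<in> carrier R" and ax: "a \<odot>\<^bsub>M\<^esub> x \<in> N" using x by (auto simp: C_def)
          have "a \<odot>\<^bsub>M\<^esub> ?z = a \<odot>\<^bsub>M\<^esub> n \<oplus>\<^bsub>M\<^esub> r \<odot>\<^bsub>M\<^esub> (a \<odot>\<^bsub>M\<^esub> x)"
            using aR q x Nc by (simp add: smult_r_distr smult_commute[of a r])
          then have "a \<odot>\<^bsub>M\<^esub> ?z \<in> N" using submoduleE(4,5)[OF Ns] aR ax q by auto
          moreover have "ann R M (a \<odot>\<^bsub>M\<^esub> ?z) = q" using ann_smult_prime[of ?z a] q aR a z by auto
          ultimately show ?thesis using q by (auto simp: A_def)
        qed simp
      qed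
    qed
    then have "?K \<in> ?Q" using K fin finite_subset by blast
    moreover have "N \<subset> ?K"
    proof
      have "n = n \<oplus>\<^bsub>M\<^esub> \<zero> \<odot>\<^bsub>M\<^esub> x" if "n \<in> N" for n using Nc[OF that] x by simp
      then show "N \<subseteq> ?K" by blast
      have "x = \<zero>\<^bsub>M\<^esub> \<oplus>\<^bsub>M\<^esub> \<one> \<odot>\<^bsub>M\<^esub> x" using x by simp
      then have "x \<in> ?K" using submodule_zero[OF Ns] R.one_closed by blast
      then show "N \<noteq> ?K" using x by blast
    qed
    ultimately show False using N(2)[of ?K] Ns K by blast
  qed
  then have "Ass R M \<subseteq> A N" by (auto simp: A_def Ass_eq)
  then show ?thesis using fin finite_subset by blast
qed

end

lemma submodule_restrict_iff:
  assumes "abelian_group M" and "submodule H R M"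
  shows "submodule K R (M\<lparr>carrier := H\<rparr>) \<longleftrightarrow> submodule K R M \<and> K \<subseteq> H"
proof -
  interpret abelian_group M by fact
  have "subgroup H (add_monoid M)" using assms(2) by (rule submodule.axioms)
  then have "subgroup K (add_monoid M\<lparr>carrier := H\<rparr>) \<longleftrightarrow> subgroup K (add_monoid M) \<and> K \<subseteq> H"
    using add.subgroup_incl[of K H] add.incl_subgroup[of H K] subgroup.subset[of K "add_monoid M\<lparr>carrier := H\<rparr>"]
    by auto
  then show ?thesis unfolding submodule_def submodule_axioms_def by auto
qed

section \<open>The nilpotent ideal of the endomorphism ring\<close>

text \<open>
  For \<open>p = ann m\<close> the condition says that the image of \<^term>\<open>loc_tors R M p\<close> in \<open>M\<^sub>p\<close> is generated by
  \<open>m / 1\<close>, hence of length one.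
\<close>

definition rank_one_tors :: "('a, 'r) ring_scheme \<Rightarrow> ('a, 'b, 'm) module_scheme \<Rightarrow> 'a set \<Rightarrow> bool"
  where "rank_one_tors R M p \<longleftrightarrow> (\<forall>m\<in>carrier M. \<forall>x\<in>loc_tors R M p. ann R M m = p \<longrightarrow>
           (\<exists>s\<in>carrier R - p. \<exists>r\<in>carrier R. s \<odot>\<^bsub>M\<^esub> x = r \<odot>\<^bsub>M\<^esub> m))"

text \<open>The ideal \<open>K\<close> of the overview, with denominators in place of residue
  fields: at each associated \<open>p\<close> the map that \<open>f\<close> induces on
  \<open>M_p\<close> kills the image of \<open>loc_tors R M p\<close>.\<close>

definition loc_null :: "('a, 'r) ring_scheme \<Rightarrow> ('a, 'b, 'm) module_scheme \<Rightarrow> ('b \<Rightarrow> 'b) set"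
  where "loc_null R M = {f \<in> carrier (End_ring R M).
           \<forall>p\<in>Ass R M. \<forall>x\<in>loc_tors R M p. \<exists>s\<in>carrier R - p. s \<odot>\<^bsub>M\<^esub> f x = \<zero>\<^bsub>M\<^esub>}"

text \<open>The associated primes of \<open>M\<close> in the support of the submodule generated by \<open>N\<close>.\<close>

definition supp_ass :: "('a, 'r) ring_scheme \<Rightarrow> ('a, 'b, 'm) module_scheme \<Rightarrow> 'b set \<Rightarrow> 'a set set"
  where "supp_ass R M N = {q \<in> Ass R M. \<exists>x\<in>N. ann R M x \<subseteq> q}"

section \<open>The endomorphism ring and its action on torsion\<close>

context module
begin

abbreviation "\<E> \<equiv> End_ring R M"

lemma EndD:
  assumes "f \<in> carrier \<E>"
  shows "f \<in> extensional (carrier M)"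
    and "x \<in> carrier M \<Longrightarrow> f x \<in> carrier M"
    and "\<lbrakk>x \<in> carrier M; y \<in> carrier M\<rbrakk> \<Longrightarrow> f (x \<oplus>\<^bsub>M\<^esub> y) = f x \<oplus>\<^bsub>M\<^esub> f y"
    and "\<lbrakk>r \<in> carrier R; x \<in> carrier M\<rbrakk> \<Longrightarrow> f (r \<odot>\<^bsub>M\<^esub> x) = r \<odot>\<^bsub>M\<^esub> f x"
  using assms by (auto simp: End_ring_def PiE_def)

lemma End_zero: assumes "f \<in> carrier \<E>" shows "f \<zero>\<^bsub>M\<^esub> = \<zero>\<^bsub>M\<^esub>"
  using EndD(4)[OF assms, of \<zero> "\<zero>\<^bsub>M\<^esub>"] EndD(2)[OF assms] by simp

lemma End_minus:
  assumes "f \<in> carrier \<E>" "x \<in> carrier M" shows "f (\<ominus>\<^bsub>M\<^esub> x) = \<ominus>\<^bsub>M\<^esub> f x"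
  using EndD(3)[OF assms(1), of "\<ominus>\<^bsub>M\<^esub> x" x] EndD(2)[OF assms(1)] End_zero[OF assms(1)] assms(2)
  by (simp add: M.l_neg M.minus_equality)

lemma EndI:
  assumes "f \<in> extensional (carrier M)"
    and "\<And>x. x \<in> carrier M \<Longrightarrow> f x \<in> carrier M"
    and "\<And>x y. \<lbrakk>x \<in> carrier M; y \<in> carrier M\<rbrakk> \<Longrightarrow> f (x \<oplus>\<^bsub>M\<^esub> y) = f x \<oplus>\<^bsub>M\<^esub> f y"
    and "\<And>r x. \<lbrakk>r \<in> carrier R; x \<in> carrier M\<rbrakk> \<Longrightarrow> f (r \<odot>\<^bsub>M\<^esub> x) = r \<odot>\<^bsub>M\<^esub> f x"
  shows "f \<in> carrier \<E>"
  using assms by (auto simp: End_ring_def PiE_def)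

lemma End_eqI:
  "\<lbrakk>f \<in> carrier \<E>; g \<in> carrier \<E>; \<And>x. x \<in> carrier M \<Longrightarrow> f x = g x\<rbrakk> \<Longrightarrow> f = g"
  using EndD(1) by (blast intro: extensionalityI)

lemma End_apply [simp]:
  assumes "x \<in> carrier M"
  shows "(f \<otimes>\<^bsub>\<E>\<^esub> g) x = f (g x)" "(f \<oplus>\<^bsub>\<E>\<^esub> g) x = f x \<oplus>\<^bsub>M\<^esub> g x" "\<one>\<^bsub>\<E>\<^esub> x = x" "\<zero>\<^bsub>\<E>\<^esub> x = \<zero>\<^bsub>M\<^esub>"
  using assms by (auto simp: End_ring_def compose_def)

lemma End_extensional:
  "f \<otimes>\<^bsub>\<E>\<^esub> g \<in> extensional (carrier M)" "f \<oplus>\<^bsub>\<E>\<^esub> g \<in> extensional (carrier M)"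
  "\<one>\<^bsub>\<E>\<^esub> \<in> extensional (carrier M)" "\<zero>\<^bsub>\<E>\<^esub> \<in> extensional (carrier M)"
  by (auto simp: End_ring_def compose_def)

lemma End_closed:
  shows "\<lbrakk>f \<in> carrier \<E>; g \<in> carrier \<E>\<rbrakk> \<Longrightarrow> f \<otimes>\<^bsub>\<E>\<^esub> g \<in> carrier \<E>"
    and "\<lbrakk>f \<in> carrier \<E>; g \<in> carrier \<E>\<rbrakk> \<Longrightarrow> f \<oplus>\<^bsub>\<E>\<^esub> g \<in> carrier \<E>"
    and "\<one>\<^bsub>\<E>\<^esub> \<in> carrier \<E>" and "\<zero>\<^bsub>\<E>\<^esub> \<in> carrier \<E>"
  by (rule EndI; simp add: End_extensional EndD smult_r_distr M.a_ac)+

lemma ring_End: "ring \<E>"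
proof (rule ringI)
  show "abelian_group \<E>"
  proof (rule abelian_groupI)
    fix f assume f: "f \<in> carrier \<E>"
    define g where "g = (\<lambda>x\<in>carrier M. \<ominus>\<^bsub>M\<^esub> f x)"
    have "g \<in> carrier \<E>"
      using f by (intro EndI) (auto simp: g_def EndD M.minus_add smult_r_minus)
    moreover have "g \<oplus>\<^bsub>\<E>\<^esub> f = \<zero>\<^bsub>\<E>\<^esub>"
      using calculation f by (intro End_eqI) (auto simp: End_closed g_def EndD M.l_neg)
    ultimately show "\<exists>g\<in>carrier \<E>. g \<oplus>\<^bsub>\<E>\<^esub> f = \<zero>\<^bsub>\<E>\<^esub>" by blast
  qed (auto intro!: End_eqI simp: End_closed EndD M.a_ac)
  show "Group.monoid \<E>"
    by (rule monoidI) (auto intro!: End_eqI simp: End_closed EndD)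
qed (auto intro!: End_eqI simp: End_closed EndD)

lemma submodule_kernel:
  assumes f: "f \<in> carrier \<E>"
  shows "submodule (a_kernel M M f) R M"
  by (rule submoduleI) (auto simp: a_kernel_def' EndD[OF f] End_zero[OF f] End_minus[OF f])

lemma ann_End: "\<lbrakk>f \<in> carrier \<E>; x \<in> carrier M\<rbrakk> \<Longrightarrow> ann R M x \<subseteq> ann R M (f x)"
  using EndD(4)[of f _ x, symmetric] End_zero by (auto simp: ann_iff)

lemma End_loc_tors:
  assumes f: "f \<in> carrier \<E>" and x: "x \<in> loc_tors R M p" and p: "primeideal p R"
  shows "f x \<in> loc_tors R M p"
proof -
  have pc: "p \<subseteq> carrier R" using p additive_subgroup.a_subset ideal.axioms(1) primeideal.axioms(1) by blast
  have xc: "x \<in> carrier M" using x by (simp add: loc_tors_def)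
  show ?thesis unfolding loc_tors_def
  proof (intro CollectI conjI ballI)
    show "f x \<in> carrier M" by (rule EndD(2)[OF f xc])
    fix a assume a: "a \<in> p"
    then obtain n s where ns: "s \<in> carrier R - p" "s \<odot>\<^bsub>M\<^esub> (a [^] (n::nat) \<odot>\<^bsub>M\<^esub> x) = \<zero>\<^bsub>M\<^esub>"
      using x by (auto simp: loc_tors_def)
    have "f (s \<odot>\<^bsub>M\<^esub> (a [^] n \<odot>\<^bsub>M\<^esub> x)) = s \<odot>\<^bsub>M\<^esub> (a [^] n \<odot>\<^bsub>M\<^esub> f x)"
      using ns(1) a pc xc EndD(4)[OF f] by (simp add: subsetD)
    then show "\<exists>n. \<exists>s\<in>carrier R - p. s \<odot>\<^bsub>M\<^esub> (a [^] (n::nat) \<odot>\<^bsub>M\<^esub> f x) = \<zero>\<^bsub>M\<^esub>"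
      using ns End_zero[OF f] by metis
  qed
qed

lemma ann_loc_tors:
  assumes "x \<in> carrier M" "ann R M x = p" "primeideal p R"
  shows "x \<in> loc_tors R M p"
proof -
  have "\<one> \<notin> p" using assms(3) ideal.one_imp_carrier primeideal.I_notcarr primeideal.axioms(1) by metis
  moreover have "a [^] (1::nat) \<odot>\<^bsub>M\<^esub> x = \<zero>\<^bsub>M\<^esub>" if "a \<in> p" for a using that assms by (auto simp: ann_iff)
  ultimately show ?thesis using assms(1) unfolding loc_tors_def
    by (intro CollectI conjI ballI exI[of _ 1] bexI[of _ \<one>]) auto
qed

lemma supp_ass_image_subset:
  assumes f: "f \<in> carrier \<E>" and N: "N \<subseteq> carrier M"
  shows "supp_ass R M (f ` N) \<subseteq> supp_ass R M N"
proof
  fix q assume "q \<in> supp_ass R M (f ` N)"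
  then obtain x where x: "q \<in> Ass R M" "x \<in> N" "ann R M (f x) \<subseteq> q" by (auto simp: supp_ass_def)
  moreover have "ann R M x \<subseteq> ann R M (f x)" using ann_End[OF f] N x(2) by auto
  ultimately show "q \<in> supp_ass R M N" by (auto simp: supp_ass_def)
qed

end

lemma (in primeideal) compl_mult:
  "\<lbrakk>s \<in> carrier R - I; t \<in> carrier R - I\<rbrakk> \<Longrightarrow> s \<otimes> t \<in> carrier R - I"
  using I_prime by auto

lemma (in primeideal) one_compl: "\<one> \<in> carrier R - I"
  using I_notcarr one_imp_carrier by auto

lemma (in primeideal) pow_mem: "\<lbrakk>a \<in> carrier R; a [^] (n::nat) \<in> I\<rbrakk> \<Longrightarrow> a \<in> I"
proof (induction n)
  case (Suc n)
  then show ?case using I_prime[of "a [^] n" a] by auto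
qed (use one_compl in auto)

text \<open>By \<open>finlen_at_eq_1_iff\<close> these are the binary Noetherian modules; in this
  form the study of endomorphisms needs no localized module.\<close>

locale rank_one_module = noetherian_module +
  assumes rank_one: "p \<in> Ass R M \<Longrightarrow> rank_one_tors R M p"
begin

text \<open>The image \<open>f m\<close> is again torsion at \<open>p\<close>, hence a multiple of
  \<open>m\<close> up to a denominator. The scalar of \<open>f\<close> at \<open>p\<close> is the
  class of \<open>r / s\<close>.\<close>

lemma scalar_on_tors:
  assumes p: "p \<in> Ass R M" and m: "m \<in> carrier M" "ann R M m = p" and f: "f \<in> carrier \<E>"
  obtains s r where "s \<in> carrier R - p" "r \<in> carrier R" "s \<odot>\<^bsub>M\<^esub> f m = r \<odot>\<^bsub>M\<^esub> m"
  using rank_one[OF p] End_loc_tors[OF f ann_loc_tors[OF m]] p m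
  unfolding rank_one_tors_def Ass_eq by blast

text \<open>The localized torsion at \<open>p\<close> is a line generated by any \<open>m\<close>
  with annihilator \<open>p\<close>, so killing one such \<open>m\<close> amounts to killing all of
  it. Conversely, if \<open>f m\<close> vanishes only up to a denominator \<open>s\<close>, then
  \<open>s m\<close> is the required witness. This form can be compared with the associated primes
  of the kernel.\<close>

lemma loc_null_iff_kernel:
  assumes f: "f \<in> carrier \<E>"
  shows "f \<in> loc_null R M \<longleftrightarrow> (\<forall>p\<in>Ass R M. \<exists>m\<in>carrier M. ann R M m = p \<and> f m = \<zero>\<^bsub>M\<^esub>)"
proof (intro iffI ballI)
  fix p assume f': "f \<in> loc_null R M" and p: "p \<in> Ass R M"
  then obtain m where m: "m \<in> carrier M" "ann R M m = p" "primeideal p R" by (auto simp: Ass_eq)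
  then obtain s where s: "s \<in> carrier R - p" "s \<odot>\<^bsub>M\<^esub> f m = \<zero>\<^bsub>M\<^esub>"
    using f' p ann_loc_tors unfolding loc_null_def by blast
  then have "f (s \<odot>\<^bsub>M\<^esub> m) = \<zero>\<^bsub>M\<^esub>" "ann R M (s \<odot>\<^bsub>M\<^esub> m) = p" "s \<odot>\<^bsub>M\<^esub> m \<in> carrier M"
    using m ann_smult_prime EndD(4)[OF f] by auto
  then show "\<exists>m\<in>carrier M. ann R M m = p \<and> f m = \<zero>\<^bsub>M\<^esub>" by blast
next
  assume *: "\<forall>p\<in>Ass R M. \<exists>m\<in>carrier M. ann R M m = p \<and> f m = \<zero>\<^bsub>M\<^esub>"
  have "\<exists>s\<in>carrier R - p. s \<odot>\<^bsub>M\<^esub> f x = \<zero>\<^bsub>M\<^esub>" if p: "p \<in> Ass R M" and x: "x \<in> loc_tors R M p" for p x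
  proof -
    obtain m where m: "m \<in> carrier M" "ann R M m = p" "f m = \<zero>\<^bsub>M\<^esub>" using * p by blast
    then obtain s r where s: "s \<in> carrier R - p" "r \<in> carrier R" "s \<odot>\<^bsub>M\<^esub> x = r \<odot>\<^bsub>M\<^esub> m"
      using rank_one[OF p] x unfolding rank_one_tors_def by blast
    have "s \<odot>\<^bsub>M\<^esub> f x = f (s \<odot>\<^bsub>M\<^esub> x)" using s(1) x EndD(4)[OF f] by (auto simp: loc_tors_def)
    also have "\<dots> = \<zero>\<^bsub>M\<^esub>" using s m EndD(4)[OF f] by simp
    finally show ?thesis using s(1) by blast
  qed
  then show "f \<in> loc_null R M" using f by (auto simp: loc_null_def)
qed

text \<open>The scalar of a nilpotent endomorphism is a nilpotent element of the residue field,
  hence zero: \<open>r^n\<close> in \<open>p\<close> forces \<open>r\<close> in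
  \<open>p\<close>.\<close>

lemma nilpotent_imp_loc_null:
  assumes f: "f \<in> carrier \<E>" and nil: "f [^]\<^bsub>\<E>\<^esub> (n::nat) = \<zero>\<^bsub>\<E>\<^esub>"
  shows "f \<in> loc_null R M"
  unfolding loc_null_iff_kernel[OF f]
proof
  interpret E: ring \<E> by (rule ring_End)
  fix p assume p: "p \<in> Ass R M"
  then obtain m where m: "m \<in> carrier M" "ann R M m = p" "primeideal p R" by (auto simp: Ass_eq)
  obtain s r where s: "s \<in> carrier R - p" "r \<in> carrier R" "s \<odot>\<^bsub>M\<^esub> f m = r \<odot>\<^bsub>M\<^esub> m"
    by (rule scalar_on_tors[OF p m(1,2) f])
  \<comment> \<open>The power \<open>f^k\<close> acts at \<open>m\<close> by
    \<open>(r / s)^k\<close>; the denominators are cleared.\<close>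
  have "s [^] k \<odot>\<^bsub>M\<^esub> (f [^]\<^bsub>\<E>\<^esub> k) m = r [^] k \<odot>\<^bsub>M\<^esub> m" for k :: nat
  proof (induction k)
    case (Suc k)
    let ?g = "f [^]\<^bsub>\<E>\<^esub> k"
    have g: "?g \<in> carrier \<E>" using f by simp
    have "s [^] Suc k \<odot>\<^bsub>M\<^esub> (f [^]\<^bsub>\<E>\<^esub> Suc k) m = s [^] k \<odot>\<^bsub>M\<^esub> ?g (s \<odot>\<^bsub>M\<^esub> f m)"
      using s(1) m(1) by (simp add: EndD[OF f] EndD[OF g] smult_assoc1)
    also have "\<dots> = s [^] k \<odot>\<^bsub>M\<^esub> ?g (r \<odot>\<^bsub>M\<^esub> m)" using s(3) by simp
    also have "\<dots> = r \<odot>\<^bsub>M\<^esub> (s [^] k \<odot>\<^bsub>M\<^esub> ?g m)"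
      using s(1,2) m(1) smult_commute[of "s [^] k" r "?g m"] by (simp add: EndD[OF g])
    also have "\<dots> = r [^] Suc k \<odot>\<^bsub>M\<^esub> m"
      using s(1,2) m(1) smult_commute[of r "r [^] k" m] by (simp add: Suc smult_assoc1)
    finally show ?case .
  qed (use m in simp)
  from this[of n] have "r [^] n \<odot>\<^bsub>M\<^esub> m = \<zero>\<^bsub>M\<^esub>" using nil s(1) m(1) by simp
  then have "r [^] n \<in> ann R M m" using s(2) by (simp add: ann_iff)
  then have "r \<in> p" using primeideal.pow_mem[OF m(3) s(2)] m(2) by simp
  then have "s \<odot>\<^bsub>M\<^esub> f m = \<zero>\<^bsub>M\<^esub>" using s m by (auto simp: ann_iff)
  then have "f (s \<odot>\<^bsub>M\<^esub> m) = \<zero>\<^bsub>M\<^esub>" "ann R M (s \<odot>\<^bsub>M\<^esub> m) = p" "s \<odot>\<^bsub>M\<^esub> m \<in> carrier M"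
    using s m ann_smult_prime EndD(4)[OF f] by auto
  then show "\<exists>m\<in>carrier M. ann R M m = p \<and> f m = \<zero>\<^bsub>M\<^esub>" by blast
qed

lemma loc_nullD:
  assumes "f \<in> loc_null R M" "p \<in> Ass R M" "x \<in> loc_tors R M p"
  obtains s where "s \<in> carrier R - p" "s \<odot>\<^bsub>M\<^esub> f x = \<zero>\<^bsub>M\<^esub>"
  using assms unfolding loc_null_def by blast

text \<open>Left multiples stay inside by linearity, right multiples because every endomorphism
  preserves the torsion, and sums by multiplying the two denominators. Negation is right
  multiplication by minus one.\<close>

lemma ideal_loc_null: "ideal (loc_null R M) \<E>"
proof (rule idealI)
  interpret E: ring \<E> by (rule ring_End)
  show "ring \<E>" by (rule ring_End)
  have tc: "x \<in> carrier M" if "x \<in> loc_tors R M p" for x p using that by (simp add: loc_tors_def)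
  have zero: "\<zero>\<^bsub>\<E>\<^esub> \<in> loc_null R M"
  proof -
    have "\<exists>s\<in>carrier R - p. s \<odot>\<^bsub>M\<^esub> \<zero>\<^bsub>\<E>\<^esub> x = \<zero>\<^bsub>M\<^esub>" if "p \<in> Ass R M" "x \<in> loc_tors R M p" for p x
      using that primeideal.one_compl[of p R] tc by (intro bexI[of _ \<one>]) (auto simp: Ass_eq)
    then show ?thesis by (auto simp: loc_null_def)
  qed
  { fix f assume f: "f \<in> loc_null R M"
    then have fE: "f \<in> carrier \<E>" by (simp add: loc_null_def)
    { fix h assume h: "h \<in> carrier \<E>"
      have "\<exists>s\<in>carrier R - p. s \<odot>\<^bsub>M\<^esub> (h \<otimes>\<^bsub>\<E>\<^esub> f) x = \<zero>\<^bsub>M\<^esub>"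
        if p: "p \<in> Ass R M" and x: "x \<in> loc_tors R M p" for p x
      proof (rule loc_nullD[OF f p x])
        fix s assume s: "s \<in> carrier R - p" "s \<odot>\<^bsub>M\<^esub> f x = \<zero>\<^bsub>M\<^esub>"
        have "h (s \<odot>\<^bsub>M\<^esub> f x) = s \<odot>\<^bsub>M\<^esub> (h \<otimes>\<^bsub>\<E>\<^esub> f) x"
          using s(1) tc[OF x] by (simp add: EndD[OF fE] EndD[OF h])
        then show ?thesis using s End_zero[OF h] by auto
      qed
      then show "h \<otimes>\<^bsub>\<E>\<^esub> f \<in> loc_null R M" using h fE by (auto simp: loc_null_def)
      have "\<exists>s\<in>carrier R - p. s \<odot>\<^bsub>M\<^esub> (f \<otimes>\<^bsub>\<E>\<^esub> h) x = \<zero>\<^bsub>M\<^esub>"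
        if p: "p \<in> Ass R M" and x: "x \<in> loc_tors R M p" for p x
      proof -
        have "h x \<in> loc_tors R M p" using End_loc_tors[OF h x] p by (simp add: Ass_eq)
        then show ?thesis using loc_nullD[OF f p] tc[OF x] by (metis End_apply(1))
      qed
      then show "f \<otimes>\<^bsub>\<E>\<^esub> h \<in> loc_null R M" using h fE by (auto simp: loc_null_def) } }
  note mult = this
  show "subgroup (loc_null R M) (add_monoid \<E>)"
  proof (rule E.add.subgroupI)
    show "loc_null R M \<subseteq> carrier \<E>" by (auto simp: loc_null_def)
    show "loc_null R M \<noteq> {}" using zero by auto
    fix f assume f: "f \<in> loc_null R M"
    then have fE: "f \<in> carrier \<E>" by (simp add: loc_null_def)
    have "\<ominus>\<^bsub>\<E>\<^esub> f = f \<otimes>\<^bsub>\<E>\<^esub> (\<ominus>\<^bsub>\<E>\<^esub> \<one>\<^bsub>\<E>\<^esub>)" using fE by (simp add: E.r_minus)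
    then show "\<ominus>\<^bsub>\<E>\<^esub> f \<in> loc_null R M" using mult[OF f] by simp
    fix g assume g: "g \<in> loc_null R M"
    then have gE: "g \<in> carrier \<E>" by (simp add: loc_null_def)
    have "\<exists>s\<in>carrier R - p. s \<odot>\<^bsub>M\<^esub> (f \<oplus>\<^bsub>\<E>\<^esub> g) x = \<zero>\<^bsub>M\<^esub>"
      if p: "p \<in> Ass R M" and x: "x \<in> loc_tors R M p" for p x
    proof -
      obtain s where s: "s \<in> carrier R - p" "s \<odot>\<^bsub>M\<^esub> f x = \<zero>\<^bsub>M\<^esub>" by (rule loc_nullD[OF f p x])
      obtain t where t: "t \<in> carrier R - p" "t \<odot>\<^bsub>M\<^esub> g x = \<zero>\<^bsub>M\<^esub>" by (rule loc_nullD[OF g p x])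
      have "(s \<otimes> t) \<odot>\<^bsub>M\<^esub> (f \<oplus>\<^bsub>\<E>\<^esub> g) x = t \<odot>\<^bsub>M\<^esub> (s \<odot>\<^bsub>M\<^esub> f x) \<oplus>\<^bsub>M\<^esub> s \<odot>\<^bsub>M\<^esub> (t \<odot>\<^bsub>M\<^esub> g x)"
        using s t tc[OF x] by (simp add: EndD[OF fE] EndD[OF gE] smult_r_distr smult_assoc1 smult_commute[of s t])
      then show ?thesis using s t primeideal.compl_mult[of p R s t] p
        by (intro bexI[of _ "s \<otimes> t"]) (auto simp: Ass_eq)
    qed
    then show "f \<oplus>\<^bsub>\<E>\<^esub> g \<in> loc_null R M" using fE gE by (auto simp: loc_null_def)
  qed
qed

text \<open>At \<open>p\<close> both products act by the product of the scalars \<open>r / s\<close>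
  and \<open>q / t\<close>, and scalars commute.\<close>

lemma commutator_loc_null:
  assumes f: "f \<in> carrier \<E>" and g: "g \<in> carrier \<E>"
  shows "(f \<otimes>\<^bsub>\<E>\<^esub> g) \<ominus>\<^bsub>\<E>\<^esub> (g \<otimes>\<^bsub>\<E>\<^esub> f) \<in> loc_null R M"
proof -
  interpret E: ring \<E> by (rule ring_End)
  let ?c = "(f \<otimes>\<^bsub>\<E>\<^esub> g) \<ominus>\<^bsub>\<E>\<^esub> (g \<otimes>\<^bsub>\<E>\<^esub> f)"
  have c: "?c \<in> carrier \<E>" using f g by simp
  have cx: "?c x = \<zero>\<^bsub>M\<^esub>" if x: "x \<in> carrier M" and eq: "f (g x) = g (f x)" for x
  proof -
    have "f \<otimes>\<^bsub>\<E>\<^esub> g = ?c \<oplus>\<^bsub>\<E>\<^esub> (g \<otimes>\<^bsub>\<E>\<^esub> f)" using f g by (simp add: E.minus_eq E.a_assoc E.l_neg)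
    then have "(f \<otimes>\<^bsub>\<E>\<^esub> g) x = ?c x \<oplus>\<^bsub>M\<^esub> (g \<otimes>\<^bsub>\<E>\<^esub> f) x" using x End_apply(2) by metis
    then have "f (g x) = ?c x \<oplus>\<^bsub>M\<^esub> f (g x)" using x eq by simp
    then show ?thesis using x EndD(2)[OF c x] EndD(2)[OF f] EndD(2)[OF g] by simp
  qed
  show ?thesis unfolding loc_null_iff_kernel[OF c]
  proof
    fix p assume p: "p \<in> Ass R M"
    then obtain m where m: "m \<in> carrier M" "ann R M m = p" "primeideal p R" by (auto simp: Ass_eq)
    obtain s r where s: "s \<in> carrier R - p" "r \<in> carrier R" "s \<odot>\<^bsub>M\<^esub> f m = r \<odot>\<^bsub>M\<^esub> m"
      by (rule scalar_on_tors[OF p m(1,2) f])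
    obtain t q where t: "t \<in> carrier R - p" "q \<in> carrier R" "t \<odot>\<^bsub>M\<^esub> g m = q \<odot>\<^bsub>M\<^esub> m"
      by (rule scalar_on_tors[OF p m(1,2) g])
    have st: "s \<otimes> t \<in> carrier R - p" by (rule primeideal.compl_mult[OF m(3) s(1) t(1)])
    \<comment> \<open>Multiplying \<open>m\<close> by both denominators makes
      \<open>f (g ?m)\<close> and \<open>g (f ?m)\<close> literally equal to \<open>q r m\<close>,
      while the annihilator is still \<open>p\<close>.\<close>
    let ?m = "(s \<otimes> t) \<odot>\<^bsub>M\<^esub> m"
    have "f (g ?m) = s \<odot>\<^bsub>M\<^esub> f (t \<odot>\<^bsub>M\<^esub> g m)"
      using s(1) t(1) m(1) by (simp add: EndD[OF f] EndD[OF g] smult_assoc1)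
    also have "\<dots> = q \<odot>\<^bsub>M\<^esub> (r \<odot>\<^bsub>M\<^esub> m)"
      unfolding t(3) s(3)[symmetric] using s(1) t(2) m(1) by (simp add: EndD[OF f] smult_commute[of s q])
    also have "\<dots> = t \<odot>\<^bsub>M\<^esub> g (s \<odot>\<^bsub>M\<^esub> f m)"
      unfolding s(3) smult_commute[OF t(2) s(2) m(1)] t(3)[symmetric]
      using s(2) t(1) m(1) by (simp add: EndD[OF g] smult_commute[of t r])
    also have "\<dots> = g (f ?m)"
      using s(1) t(1) m(1) smult_commute[of s t "g (f m)"] by (simp add: EndD[OF f] EndD[OF g] smult_assoc1)
    finally have "?c ?m = \<zero>\<^bsub>M\<^esub>" using cx[of ?m] s(1) t(1) m(1) by simp
    moreover have "ann R M ?m = p" using st m ann_smult_prime[of m "s \<otimes> t"] by auto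
    moreover have "?m \<in> carrier M" using s(1) t(1) m(1) by simp
    ultimately show "\<exists>m\<in>carrier M. ann R M m = p \<and> ?c m = \<zero>\<^bsub>M\<^esub>" by blast
  qed
qed

section \<open>Nilpotency of the ideal through shrinking supports\<close>

lemma supp_ass_empty:
  assumes N: "N \<subseteq> carrier M" and closed: "\<And>r x. \<lbrakk>r \<in> carrier R; x \<in> N\<rbrakk> \<Longrightarrow> r \<odot>\<^bsub>M\<^esub> x \<in> N"
    and empty: "supp_ass R M N = {}" and x: "x \<in> N"
  shows "x = \<zero>\<^bsub>M\<^esub>"
proof (rule ccontr)
  assume "x \<noteq> \<zero>\<^bsub>M\<^esub>"
  then obtain r where "r \<in> carrier R" "primeideal (ann R M (r \<odot>\<^bsub>M\<^esub> x)) R"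
    using exists_prime_ann_nonzero N x by blast
  then have "ann R M (r \<odot>\<^bsub>M\<^esub> x) \<in> supp_ass R M N"
    using closed N x by (auto simp: supp_ass_def Ass_eq)
  then show False using empty by simp
qed

lemma card_supp_ass_image:
  assumes N: "N \<subseteq> carrier M" and closed: "\<And>r x. \<lbrakk>r \<in> carrier R; x \<in> N\<rbrakk> \<Longrightarrow> r \<odot>\<^bsub>M\<^esub> x \<in> N"
    and ne: "supp_ass R M N \<noteq> {}" and f: "f \<in> loc_null R M"
  shows "card (supp_ass R M (f ` N)) < card (supp_ass R M N)"
proof (rule psubset_card_mono)
  have fE: "f \<in> carrier \<E>" using f by (simp add: loc_null_def)
  have fin: "finite (supp_ass R M N)" using finite_Ass by (auto simp: supp_ass_def)
  then show "finite (supp_ass R M N)" .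
  obtain q where q: "q \<in> supp_ass R M N" "\<And>q'. q' \<in> supp_ass R M N \<Longrightarrow> q' \<subseteq> q \<Longrightarrow> q = q'"
    using finite_has_minimal[OF fin ne] by blast
  then have qA: "q \<in> Ass R M" and qp: "primeideal q R" by (auto simp: supp_ass_def Ass_eq)
  interpret q: primeideal q R by (rule qp)
  have tors: "x \<in> loc_tors R M q" if x: "x \<in> N" for x
    unfolding loc_tors_def
  proof (intro CollectI conjI ballI, goal_cases)
    case 1
    show ?case using x N by auto
  next
    case (2 a)
    show ?case
    proof (rule ccontr)
      assume neg: "\<not> ?thesis"
      have aR: "a \<in> carrier R" using 2 by (rule q.Icarr)
      have xM: "x \<in> carrier M" using x N by auto
      \<comment> \<open>Localizes at \<open>q\<close> and inverts \<open>a\<close> at the same time.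
        By \<open>neg\<close> this set misses \<open>ann x\<close>, so a multiple of
        \<open>x\<close> has a prime annihilator disjoint from it. Taking \<open>n = 0\<close> shows
        that this prime lies in \<open>q\<close>, taking \<open>s = 1\<close> that it omits
        \<open>a\<close>; it belongs to the support of \<open>N\<close>, against the minimality of
        \<open>q\<close>.\<close>
      let ?T = "{s \<otimes> a [^] n | s n. s \<in> carrier R - q \<and> n \<in> (UNIV :: nat set)}"
      have "\<exists>r\<in>carrier R. primeideal (ann R M (r \<odot>\<^bsub>M\<^esub> x)) R \<and> ann R M (r \<odot>\<^bsub>M\<^esub> x) \<inter> ?T = {}"
      proof (rule exists_prime_ann[OF xM, of ?T])
        show "?T \<subseteq> carrier R" using aR by auto
        show "\<one> \<in> ?T" using q.one_compl by (intro CollectI exI[of _ \<one>] exI[of _ 0]) auto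
        show "ann R M x \<inter> ?T = {}" using neg aR xM by (auto simp: ann_iff smult_assoc1)
        fix u v assume "u \<in> ?T" "v \<in> ?T"
        then obtain s t and n k :: nat where
          uv: "u = s \<otimes> a [^] n" "v = t \<otimes> a [^] k" "s \<in> carrier R - q" "t \<in> carrier R - q" by auto
        have "u \<otimes> v = (s \<otimes> t) \<otimes> a [^] (n + k)"
          using uv aR by (simp add: R.nat_pow_mult[symmetric] R.m_ac)
        then show "u \<otimes> v \<in> ?T" using q.compl_mult[OF uv(3,4)] by blast
      qed blast
      then obtain r where r: "r \<in> carrier R" "primeideal (ann R M (r \<odot>\<^bsub>M\<^esub> x)) R" "ann R M (r \<odot>\<^bsub>M\<^esub> x) \<inter> ?T = {}"
        by blast
      let ?q = "ann R M (r \<odot>\<^bsub>M\<^esub> x)"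
      have "?q \<in> supp_ass R M N" using r x xM closed by (auto simp: supp_ass_def Ass_eq)
      moreover have "?q \<subseteq> q"
      proof
        fix s assume s: "s \<in> ?q"
        show "s \<in> q"
        proof (rule ccontr)
          assume "s \<notin> q"
          moreover have "s \<in> carrier R" using s by (simp add: ann_iff)
          ultimately have "s \<otimes> a [^] (0::nat) \<in> ?T" by blast
          then have "s \<in> ?T" using \<open>s \<in> carrier R\<close> by simp
          then show False using s r(3) by blast
        qed
      qed
      ultimately have "q = ?q" using q by blast
      then have "a \<in> ?q" using 2 by simp
      moreover have "\<one> \<otimes> a [^] (1::nat) \<in> ?T" using q.one_compl by blast
      ultimately show False using r(3) aR by auto
    qed
  qed
  have "q \<notin> supp_ass R M (f ` N)"
  proof
    assume "q \<in> supp_ass R M (f ` N)"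
    then obtain x where x: "x \<in> N" "ann R M (f x) \<subseteq> q" by (auto simp: supp_ass_def)
    obtain s where "s \<in> carrier R - q" "s \<odot>\<^bsub>M\<^esub> f x = \<zero>\<^bsub>M\<^esub>" by (rule loc_nullD[OF f qA tors[OF x(1)]])
    then show False using x by (auto simp: ann_iff)
  qed
  moreover have "supp_ass R M (f ` N) \<subseteq> supp_ass R M N" by (rule supp_ass_image_subset[OF fE N])
  ultimately show "supp_ass R M (f ` N) \<subset> supp_ass R M N" using q(1) by blast
qed

lemma ideal_power_loc_null:
  assumes "h \<in> ideal_power \<E> (loc_null R M) n" and "N \<subseteq> carrier M"
    and "\<And>r x. \<lbrakk>r \<in> carrier R; x \<in> N\<rbrakk> \<Longrightarrow> r \<odot>\<^bsub>M\<^esub> x \<in> N"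
    and "card (supp_ass R M N) \<le> n" and "x \<in> N"
  shows "h x = \<zero>\<^bsub>M\<^esub>"
  using assms
proof (induction n arbitrary: h N x)
  case 0
  have "finite (supp_ass R M N)" using finite_Ass by (auto simp: supp_ass_def)
  then have "x = \<zero>\<^bsub>M\<^esub>" using supp_ass_empty[OF 0(2,3) _ 0(5)] 0(4) by simp
  then show ?case using End_zero 0(1) by simp
next
  case (Suc n)
  have xM: "x \<in> carrier M" using Suc.prems by auto
  have "h \<in> ideal_prod \<E> (ideal_power \<E> (loc_null R M) n) (loc_null R M)" using Suc.prems by simp
  then show ?case
  proof induction
    case (prod i j)
    then have jE: "j \<in> carrier \<E>" by (simp add: loc_null_def)
    have card: "card (supp_ass R M (j ` N)) \<le> n"
    proof (cases "supp_ass R M N = {}")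
      \<comment> \<open>With no prime left there is no strict drop, but the support of the image is
        then empty too.\<close>
      case True
      then have "supp_ass R M (j ` N) = {}"
        using supp_ass_image_subset[OF jE Suc.prems(2)] by simp
      then show ?thesis by simp
    next
      case False
      show ?thesis using card_supp_ass_image[OF Suc.prems(2,3) False prod(2)] Suc.prems(4) by simp
    qed
    have closed: "r \<odot>\<^bsub>M\<^esub> y \<in> j ` N" if ry: "r \<in> carrier R" "y \<in> j ` N" for r y
    proof -
      obtain z where z: "z \<in> N" "y = j z" using ry(2) by blast
      then have "r \<odot>\<^bsub>M\<^esub> y = j (r \<odot>\<^bsub>M\<^esub> z)" using EndD(4)[OF jE ry(1)] Suc.prems(2) by auto
      then show ?thesis using Suc.prems(3)[OF ry(1) z(1)] by simp
    qed
    have "j ` N \<subseteq> carrier M" using EndD(2)[OF jE] Suc.prems(2) by auto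
    from Suc.IH[OF prod(1) this closed card] have "i (j x) = \<zero>\<^bsub>M\<^esub>" using Suc.prems(5) by simp
    then show ?case using xM by simp
  next
    case (sum s1 s2)
    then show ?case using xM by simp
  qed
qed

lemma ideal_power_ideal: "ideal (ideal_power \<E> (loc_null R M) n) \<E>"
proof (induction n)
  case 0
  show ?case using ring.oneideal[OF ring_End] by simp
next
  case (Suc n)
  show ?case using ring.ideal_prod_is_ideal[OF ring_End Suc ideal_loc_null] by simp
qed

lemma ideal_power_loc_null_zero: "ideal_power \<E> (loc_null R M) (card (Ass R M)) = {\<zero>\<^bsub>\<E>\<^esub>}"
proof
  interpret I: ideal "ideal_power \<E> (loc_null R M) (card (Ass R M))" \<E> by (rule ideal_power_ideal)
  show "{\<zero>\<^bsub>\<E>\<^esub>} \<subseteq> ideal_power \<E> (loc_null R M) (card (Ass R M))" using I.zero_closed by simp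
  have card: "card (supp_ass R M (carrier M)) \<le> card (Ass R M)"
    by (rule card_mono[OF finite_Ass]) (auto simp: supp_ass_def)
  show "ideal_power \<E> (loc_null R M) (card (Ass R M)) \<subseteq> {\<zero>\<^bsub>\<E>\<^esub>}"
  proof
    fix h assume h: "h \<in> ideal_power \<E> (loc_null R M) (card (Ass R M))"
    have "h x = \<zero>\<^bsub>M\<^esub>" if "x \<in> carrier M" for x
      using ideal_power_loc_null[OF h subset_refl smult_closed card that] .
    then have "h = \<zero>\<^bsub>\<E>\<^esub>" using I.Icarr[OF h] by (intro End_eqI) (simp_all add: End_closed)
    then show "h \<in> {\<zero>\<^bsub>\<E>\<^esub>}" by simp
  qed
qed

lemma pow_in_ideal_power:
  assumes f: "f \<in> loc_null R M"
  shows "f [^]\<^bsub>\<E>\<^esub> n \<in> ideal_power \<E> (loc_null R M) n"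
proof (induction n)
  case (Suc n)
  interpret E: ring \<E> by (rule ring_End)
  show ?case using ideal_prod.prod[OF Suc f, of \<E>] by simp
qed (simp add: End_closed(3))

lemma nilpotents_eq: "nilpotents \<E> = loc_null R M"
proof
  show "nilpotents \<E> \<subseteq> loc_null R M"
    using nilpotent_imp_loc_null by (auto simp: nilpotents_def nilpotent_elem_def)
  show "loc_null R M \<subseteq> nilpotents \<E>"
  proof
    fix f assume f: "f \<in> loc_null R M"
    then have "f [^]\<^bsub>\<E>\<^esub> card (Ass R M) = \<zero>\<^bsub>\<E>\<^esub>"
      using pow_in_ideal_power[OF f, of "card (Ass R M)"] by (simp add: ideal_power_loc_null_zero)
    moreover have "f \<in> carrier \<E>" using f by (simp add: loc_null_def)
    ultimately show "f \<in> nilpotents \<E>" by (auto simp: nilpotents_def nilpotent_elem_def)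
  qed
qed

lemma cring_End_Quot: "cring (\<E> Quot nilpotents \<E>)"
proof -
  interpret I: ideal "nilpotents \<E>" \<E> unfolding nilpotents_eq by (rule ideal_loc_null)
  interpret Q: ring "\<E> Quot nilpotents \<E>" by (rule I.quotient_is_ring)
  show ?thesis
  proof (unfold_locales)
    fix U V :: "('c \<Rightarrow> 'c) set" assume "U \<in> carrier (\<E> Quot nilpotents \<E>)" "V \<in> carrier (\<E> Quot nilpotents \<E>)"
    then obtain f g where f: "f \<in> carrier \<E>" "U = nilpotents \<E> +>\<^bsub>\<E>\<^esub> f"
      and g: "g \<in> carrier \<E>" "V = nilpotents \<E> +>\<^bsub>\<E>\<^esub> g" by (auto simp: FactRing_def A_RCOSETS_def')
    have "nilpotents \<E> +>\<^bsub>\<E>\<^esub> (f \<otimes>\<^bsub>\<E>\<^esub> g) = nilpotents \<E> +>\<^bsub>\<E>\<^esub> (g \<otimes>\<^bsub>\<E>\<^esub> f)"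
      using commutator_loc_null[OF f(1) g(1)] f g
      by (subst I.quotient_eq_iff_same_a_r_cos[OF I.ideal_axioms, symmetric]) (auto simp: nilpotents_eq)
    then show "U \<otimes>\<^bsub>\<E> Quot nilpotents \<E>\<^esub> V = V \<otimes>\<^bsub>\<E> Quot nilpotents \<E>\<^esub> U"
      using f g by (simp add: FactRing_def I.rcoset_mult_add)
  qed
qed

end

section \<open>Submodules of a localization\<close>

text \<open>The operations of \<open>loc_module\<close> are unions over representatives. Once the
  resulting class is known to be independent of them, this evaluates the union.\<close>

lemma UN_const2:
  assumes "x \<noteq> {}" "y \<noteq> {}" "\<And>m s n t. \<lbrakk>(m, s) \<in> x; (n, t) \<in> y\<rbrakk> \<Longrightarrow> F m s n t = c"
  shows "(\<Union>(m, s)\<in>x. \<Union>(n, t)\<in>y. F m s n t) = c"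
proof -
  have "(\<Union>(n, t)\<in>y. F m s n t) = c" if "(m, s) \<in> x" for m s
  proof -
    have "(\<Union>(n, t)\<in>y. F m s n t) = (\<Union>z\<in>y. c)" using assms(3)[OF that] 
      by - (rule SUP_cong[OF refl], clarsimp)
    then show ?thesis using assms(2) by simp
  qed
  then have "(\<Union>(m, s)\<in>x. \<Union>(n, t)\<in>y. F m s n t) = (\<Union>z\<in>x. c)"
    by - (rule SUP_cong[OF refl], clarsimp)
  then show ?thesis using assms(1) by simp
qed

section \<open>Fractions and the correspondence of submodules\<close>

locale module_loc = module +
  fixes S
  assumes S_carrier: "S \<subseteq> carrier R" and S_one: "\<one> \<in> S"
    and S_mult: "\<lbrakk>s \<in> S; t \<in> S\<rbrakk> \<Longrightarrow> s \<otimes> t \<in> S"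
begin

abbreviation "fr \<equiv> frac R M S"
abbreviation "fr\<^sub>R \<equiv> frac R (self_module R) S"
abbreviation "L \<equiv> loc_module R M S"
abbreviation "RS \<equiv> loc_ring R S"

lemma S_closed [simp]: "s \<in> S \<Longrightarrow> s \<in> carrier R"
  using S_carrier by auto

lemma loc_rel_iff: "((m, s), (n, t)) \<in> loc_rel R M S \<longleftrightarrow>
    m \<in> carrier M \<and> n \<in> carrier M \<and> s \<in> S \<and> t \<in> S \<and> (\<exists>u\<in>S. (u \<otimes> t) \<odot>\<^bsub>M\<^esub> m = (u \<otimes> s) \<odot>\<^bsub>M\<^esub> n)"
  by (auto simp: loc_rel_def smult_assoc1)

lemma equiv_loc_rel: "equiv (carrier M \<times> S) (loc_rel R M S)"
proof (rule equivI)
  show "loc_rel R M S \<subseteq> (carrier M \<times> S) \<times> (carrier M \<times> S)" by (auto simp: loc_rel_def)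
  show "refl_on (carrier M \<times> S) (loc_rel R M S)"
    using S_one by (auto simp: refl_on_def loc_rel_iff)
  show "sym (loc_rel R M S)" by (auto simp: sym_def loc_rel_iff) metis
  show "trans (loc_rel R M S)"
  proof (rule transI, clarify)
    fix m s n t k w
    assume "((m, s), (n, t)) \<in> loc_rel R M S" "((n, t), (k, w)) \<in> loc_rel R M S"
    then obtain u v where uv: "m \<in> carrier M" "n \<in> carrier M" "k \<in> carrier M" "s \<in> S" "t \<in> S" "w \<in> S"
      "u \<in> S" "v \<in> S" "(u \<otimes> t) \<odot>\<^bsub>M\<^esub> m = (u \<otimes> s) \<odot>\<^bsub>M\<^esub> n" "(v \<otimes> w) \<odot>\<^bsub>M\<^esub> n = (v \<otimes> t) \<odot>\<^bsub>M\<^esub> k"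
      unfolding loc_rel_iff by blast
    \<comment> \<open>The witness for the outer pair is \<open>u v t\<close>: the factor
      \<open>t\<close> lets both given relations be applied in turn.\<close>
    have "((u \<otimes> v \<otimes> t) \<otimes> w) \<odot>\<^bsub>M\<^esub> m = (v \<otimes> w) \<odot>\<^bsub>M\<^esub> ((u \<otimes> t) \<odot>\<^bsub>M\<^esub> m)"
      using uv(1-8) by (simp add: smult_assoc1[symmetric] R.m_ac)
    also have "\<dots> = (u \<otimes> s) \<odot>\<^bsub>M\<^esub> ((v \<otimes> w) \<odot>\<^bsub>M\<^esub> n)"
      unfolding uv(9) using uv(1-8) by (simp add: smult_assoc1[symmetric] R.m_ac)
    also have "\<dots> = ((u \<otimes> v \<otimes> t) \<otimes> s) \<odot>\<^bsub>M\<^esub> k"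
      unfolding uv(10) using uv(1-8) by (simp add: smult_assoc1[symmetric] R.m_ac)
    finally show "((m, s), (k, w)) \<in> loc_rel R M S"
      unfolding loc_rel_iff using uv(1-8) S_mult by blast
  qed
qed

lemma fr_eq_iff:
  assumes "m \<in> carrier M" "n \<in> carrier M" "s \<in> S" "t \<in> S"
  shows "fr m s = fr n t \<longleftrightarrow> (\<exists>u\<in>S. (u \<otimes> t) \<odot>\<^bsub>M\<^esub> m = (u \<otimes> s) \<odot>\<^bsub>M\<^esub> n)"
  unfolding frac_def using eq_equiv_class_iff[OF equiv_loc_rel, of "(m, s)" "(n, t)"] assms
  by (auto simp: loc_rel_iff)

lemma fr_eqI:
  assumes "m \<in> carrier M" "n \<in> carrier M" "s \<in> S" "t \<in> S" "u \<in> S" "(u \<otimes> t) \<odot>\<^bsub>M\<^esub> m = (u \<otimes> s) \<odot>\<^bsub>M\<^esub> n"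
  shows "fr m s = fr n t"
  using fr_eq_iff assms by blast

lemma mem_fr: "(n, t) \<in> fr m s \<longleftrightarrow> m \<in> carrier M \<and> n \<in> carrier M \<and> s \<in> S \<and> t \<in> S \<and>
    (\<exists>u\<in>S. (u \<otimes> t) \<odot>\<^bsub>M\<^esub> m = (u \<otimes> s) \<odot>\<^bsub>M\<^esub> n)"
  by (simp add: frac_def loc_rel_iff)

lemma fr_nonempty: "\<lbrakk>m \<in> carrier M; s \<in> S\<rbrakk> \<Longrightarrow> fr m s \<noteq> {}"
  using S_one mem_fr[of m s m s] by blast

lemma fr_cancel:
  "\<lbrakk>m \<in> carrier M; s \<in> S; t \<in> S\<rbrakk> \<Longrightarrow> fr (t \<odot>\<^bsub>M\<^esub> m) (t \<otimes> s) = fr m s"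
  using S_one S_mult by (intro fr_eqI[of _ _ _ _ \<one>]) (auto simp: smult_assoc1[symmetric] R.m_ac)

lemma carrier_L: "carrier L = {fr m s | m s. m \<in> carrier M \<and> s \<in> S}"
  by (auto simp: loc_module_def quotient_def frac_def)

lemma fr_carrier: "\<lbrakk>m \<in> carrier M; s \<in> S\<rbrakk> \<Longrightarrow> fr m s \<in> carrier L"
  unfolding carrier_L by blast

lemma mem_fr_self: "(b, t) \<in> fr\<^sub>R a s \<longleftrightarrow> a \<in> carrier R \<and> b \<in> carrier R \<and> s \<in> S \<and> t \<in> S \<and>
    (\<exists>u\<in>S. u \<otimes> (t \<otimes> a) = u \<otimes> (s \<otimes> b))"
  by (simp add: frac_def loc_rel_def self_module_def)

lemma carrier_RS: "carrier RS = {fr\<^sub>R a s | a s. a \<in> carrier R \<and> s \<in> S}"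
  by (auto simp: loc_ring_def loc_module_def quotient_def frac_def self_module_def)

lemma carrier_RSE:
  assumes "a \<in> carrier RS"
  obtains b s where "a = fr\<^sub>R b s" "b \<in> carrier R" "s \<in> S"
  using assms unfolding carrier_RS by blast

lemma fr_carrier_RS: "\<lbrakk>b \<in> carrier R; s \<in> S\<rbrakk> \<Longrightarrow> fr\<^sub>R b s \<in> carrier RS"
  unfolding carrier_RS by blast

text \<open>If \<open>u\<close> and \<open>v\<close> witness the two changes of representatives,
  \<open>u v\<close> witnesses that the result does not change. The same product serves for
  \<open>smult_fr\<close>.\<close>

lemma add_fr:
  assumes "m \<in> carrier M" "n \<in> carrier M" "s \<in> S" "t \<in> S"
  shows "fr m s \<oplus>\<^bsub>L\<^esub> fr n t = fr (t \<odot>\<^bsub>M\<^esub> m \<oplus>\<^bsub>M\<^esub> s \<odot>\<^bsub>M\<^esub> n) (s \<otimes> t)"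
  unfolding loc_module_def ring.simps
proof (simp, rule UN_const2)
  show "fr m s \<noteq> {}" "fr n t \<noteq> {}" using assms by (simp_all add: fr_nonempty)
  fix m' s' n' t' assume "(m', s') \<in> fr m s" "(n', t') \<in> fr n t"
  then obtain u v where c: "m' \<in> carrier M" "n' \<in> carrier M" "s' \<in> S" "t' \<in> S" "u \<in> S" "v \<in> S"
    and u: "(u \<otimes> s') \<odot>\<^bsub>M\<^esub> m = (u \<otimes> s) \<odot>\<^bsub>M\<^esub> m'" and v: "(v \<otimes> t') \<odot>\<^bsub>M\<^esub> n = (v \<otimes> t) \<odot>\<^bsub>M\<^esub> n'"
    unfolding mem_fr by blast
  note cc = c assms
  have "((u \<otimes> v) \<otimes> (s \<otimes> t)) \<odot>\<^bsub>M\<^esub> (t' \<odot>\<^bsub>M\<^esub> m' \<oplus>\<^bsub>M\<^esub> s' \<odot>\<^bsub>M\<^esub> n')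
      = (v \<otimes> t \<otimes> t') \<odot>\<^bsub>M\<^esub> ((u \<otimes> s) \<odot>\<^bsub>M\<^esub> m') \<oplus>\<^bsub>M\<^esub> (u \<otimes> s \<otimes> s') \<odot>\<^bsub>M\<^esub> ((v \<otimes> t) \<odot>\<^bsub>M\<^esub> n')"
    using cc by (simp add: smult_r_distr smult_assoc1[symmetric] R.m_ac)
  also have "\<dots> = ((u \<otimes> v) \<otimes> (s' \<otimes> t')) \<odot>\<^bsub>M\<^esub> (t \<odot>\<^bsub>M\<^esub> m \<oplus>\<^bsub>M\<^esub> s \<odot>\<^bsub>M\<^esub> n)"
    unfolding u[symmetric] v[symmetric] using cc by (simp add: smult_r_distr smult_assoc1[symmetric] R.m_ac)
  finally show "fr (t' \<odot>\<^bsub>M\<^esub> m' \<oplus>\<^bsub>M\<^esub> s' \<odot>\<^bsub>M\<^esub> n') (s' \<otimes> t') = fr (t \<odot>\<^bsub>M\<^esub> m \<oplus>\<^bsub>M\<^esub> s \<odot>\<^bsub>M\<^esub> n) (s \<otimes> t)"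
    using cc S_mult by (intro fr_eqI[of _ _ _ _ "u \<otimes> v"]) auto
qed

lemma smult_fr:
  assumes "a \<in> carrier R" "n \<in> carrier M" "s \<in> S" "t \<in> S"
  shows "fr\<^sub>R a s \<odot>\<^bsub>L\<^esub> fr n t = fr (a \<odot>\<^bsub>M\<^esub> n) (s \<otimes> t)"
  unfolding loc_module_def module.simps
proof (rule UN_const2)
  show "fr\<^sub>R a s \<noteq> {}" using mem_fr_self[of a s a s] S_one assms by blast
  show "fr n t \<noteq> {}" using assms by (simp_all add: fr_nonempty)
  fix b s' n' t' assume "(b, s') \<in> fr\<^sub>R a s" "(n', t') \<in> fr n t"
  then obtain u v where c: "b \<in> carrier R" "n' \<in> carrier M" "s' \<in> S" "t' \<in> S" "u \<in> S" "v \<in> S"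
    and u: "u \<otimes> (s' \<otimes> a) = u \<otimes> (s \<otimes> b)" and v: "(v \<otimes> t') \<odot>\<^bsub>M\<^esub> n = (v \<otimes> t) \<odot>\<^bsub>M\<^esub> n'"
    unfolding mem_fr mem_fr_self by blast
  note cc = c assms
  have "((u \<otimes> v) \<otimes> (s \<otimes> t)) \<odot>\<^bsub>M\<^esub> (b \<odot>\<^bsub>M\<^esub> n') = (u \<otimes> (s \<otimes> b)) \<odot>\<^bsub>M\<^esub> ((v \<otimes> t) \<odot>\<^bsub>M\<^esub> n')"
    using cc by (simp add: smult_assoc1[symmetric] R.m_ac)
  also have "\<dots> = ((u \<otimes> v) \<otimes> (s' \<otimes> t')) \<odot>\<^bsub>M\<^esub> (a \<odot>\<^bsub>M\<^esub> n)"
    unfolding u[symmetric] v[symmetric] using cc by (simp add: smult_assoc1[symmetric] R.m_ac)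
  finally show "fr (b \<odot>\<^bsub>M\<^esub> n') (s' \<otimes> t') = fr (a \<odot>\<^bsub>M\<^esub> n) (s \<otimes> t)"
    using cc S_mult by (intro fr_eqI[of _ _ _ _ "u \<otimes> v"]) auto
qed

lemma zero_L: "\<zero>\<^bsub>L\<^esub> = fr \<zero>\<^bsub>M\<^esub> \<one>"
  by (simp add: loc_module_def)

lemma add_fr_minus:
  assumes "m \<in> carrier M" "s \<in> S"
  shows "fr (\<ominus>\<^bsub>M\<^esub> m) s \<oplus>\<^bsub>L\<^esub> fr m s = \<zero>\<^bsub>L\<^esub>"
proof -
  have "fr (\<ominus>\<^bsub>M\<^esub> m) s \<oplus>\<^bsub>L\<^esub> fr m s = fr \<zero>\<^bsub>M\<^esub> (s \<otimes> s)"
    using assms by (simp add: add_fr smult_r_minus M.l_neg)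
  also have "\<dots> = fr \<zero>\<^bsub>M\<^esub> \<one>" using assms S_one S_mult by (intro fr_eqI[of _ _ _ _ \<one>]) auto
  finally show ?thesis by (simp add: zero_L)
qed

lemma abelian_group_L: "abelian_group L"
proof (rule abelian_groupI)
  show "\<zero>\<^bsub>L\<^esub> \<in> carrier L" using S_one by (auto simp: zero_L carrier_L)
  fix x assume "x \<in> carrier L"
  then obtain m s where x: "x = fr m s" "m \<in> carrier M" "s \<in> S" by (auto simp: carrier_L)
  show "\<zero>\<^bsub>L\<^esub> \<oplus>\<^bsub>L\<^esub> x = x" using x S_one by (simp add: zero_L add_fr)
  have "fr (\<ominus>\<^bsub>M\<^esub> m) s \<oplus>\<^bsub>L\<^esub> x = \<zero>\<^bsub>L\<^esub>" using x by (simp add: add_fr_minus)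
  then show "\<exists>y\<in>carrier L. y \<oplus>\<^bsub>L\<^esub> x = \<zero>\<^bsub>L\<^esub>" using x unfolding carrier_L by blast
  fix y assume "y \<in> carrier L"
  then obtain n t where y: "y = fr n t" "n \<in> carrier M" "t \<in> S" by (auto simp: carrier_L)
  show "x \<oplus>\<^bsub>L\<^esub> y \<in> carrier L" using x y S_mult by (simp add: add_fr fr_carrier)
  show "x \<oplus>\<^bsub>L\<^esub> y = y \<oplus>\<^bsub>L\<^esub> x" using x y by (simp add: add_fr R.m_comm M.a_comm)
  fix z assume "z \<in> carrier L"
  then obtain k w where z: "z = fr k w" "k \<in> carrier M" "w \<in> S" by (auto simp: carrier_L)
  show "x \<oplus>\<^bsub>L\<^esub> y \<oplus>\<^bsub>L\<^esub> z = x \<oplus>\<^bsub>L\<^esub> (y \<oplus>\<^bsub>L\<^esub> z)"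
    using x y z S_mult by (simp add: add_fr smult_r_distr smult_assoc1[symmetric] R.m_ac M.a_ac)
qed

text \<open>
  Contraction and extension identify the submodules of the localization with the saturated submodules of
  \<open>M\<close>, so that lengths of localized modules can be computed inside \<open>M\<close>.
\<close>

definition sat_submodule :: "'c set \<Rightarrow> bool"
  where "sat_submodule N \<longleftrightarrow> submodule N R M \<and> (\<forall>s\<in>S. \<forall>x\<in>carrier M. s \<odot>\<^bsub>M\<^esub> x \<in> N \<longrightarrow> x \<in> N)"

definition contr :: "('c \<times> 'a) set set \<Rightarrow> 'c set"
  where "contr H = {x \<in> carrier M. fr x \<one> \<in> H}"

definition ext :: "'c set \<Rightarrow> ('c \<times> 'a) set set"
  where "ext N = {fr x s | x s. x \<in> N \<and> s \<in> S}"

definition sat_chain :: "'c set \<Rightarrow> nat \<Rightarrow> bool"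
  where "sat_chain N n \<longleftrightarrow>
    (\<exists>H. (\<forall>i\<le>n. sat_submodule (H i) \<and> H i \<subseteq> N) \<and> (\<forall>i<n. H i \<subset> H (Suc i)))"

definition sat_length :: "'c set \<Rightarrow> enat"
  where "sat_length N = Sup {enat n | n. sat_chain N n}"

lemma fr_ext: "\<lbrakk>x \<in> N; s \<in> S\<rbrakk> \<Longrightarrow> fr x s \<in> ext N"
  unfolding ext_def by blast

lemma sat_submoduleD:
  assumes "sat_submodule N"
  shows "submodule N R M" and "\<lbrakk>s \<in> S; x \<in> carrier M; s \<odot>\<^bsub>M\<^esub> x \<in> N\<rbrakk> \<Longrightarrow> x \<in> N"
  using assms by (auto simp: sat_submodule_def)

lemma submodule_ext:
  assumes N: "submodule N R M"
  shows "submodule (ext N) RS L"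
proof -
  interpret L: abelian_group L by (rule abelian_group_L)
  note Nc = subsetD[OF submoduleE(1)[OF N]]
  have sm: "a \<odot>\<^bsub>L\<^esub> x \<in> ext N" if ax: "a \<in> carrier RS" "x \<in> ext N" for a x
  proof -
    obtain b s where a: "a = fr\<^sub>R b s" "b \<in> carrier R" "s \<in> S" by (rule carrier_RSE[OF ax(1)])
    obtain y t where x: "x = fr y t" "y \<in> N" "t \<in> S" using ax(2) by (auto simp: ext_def)
    have "a \<odot>\<^bsub>L\<^esub> x = fr (b \<odot>\<^bsub>M\<^esub> y) (s \<otimes> t)" using a x Nc by (simp add: smult_fr)
    then show ?thesis using submoduleE(4)[OF N a(2) x(2)] S_mult[OF a(3) x(3)] by (simp add: fr_ext)
  qed
  have "subgroup (ext N) (add_monoid L)"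
  proof (rule L.add.subgroupI)
    show "ext N \<subseteq> carrier L" using Nc by (auto simp: ext_def carrier_L)
    show "ext N \<noteq> {}" using fr_ext[OF submodule_zero[OF N] S_one] by blast
    fix x assume "x \<in> ext N"
    then obtain m s where x: "x = fr m s" "m \<in> N" "s \<in> S" by (auto simp: ext_def)
    have "fr (\<ominus>\<^bsub>M\<^esub> m) s \<oplus>\<^bsub>L\<^esub> x = \<zero>\<^bsub>L\<^esub>"
      using x Nc by (simp add: add_fr_minus)
    then have "\<ominus>\<^bsub>L\<^esub> x = fr (\<ominus>\<^bsub>M\<^esub> m) s" using x Nc by (intro L.minus_equality) (simp_all add: fr_carrier)
    then show "\<ominus>\<^bsub>L\<^esub> x \<in> ext N" using x submoduleE(3)[OF N] by (simp add: fr_ext)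
    fix y assume "y \<in> ext N"
    then obtain n t where y: "y = fr n t" "n \<in> N" "t \<in> S" by (auto simp: ext_def)
    then have "x \<oplus>\<^bsub>L\<^esub> y = fr (t \<odot>\<^bsub>M\<^esub> m \<oplus>\<^bsub>M\<^esub> s \<odot>\<^bsub>M\<^esub> n) (s \<otimes> t)" using x Nc by (simp add: add_fr)
    then show "x \<oplus>\<^bsub>L\<^esub> y \<in> ext N" using x y submoduleE(4,5)[OF N] S_mult by (simp add: fr_ext)
  qed
  then show ?thesis using sm by (auto simp: submodule_def submodule_axioms_def)
qed

lemma sat_submodule_contr:
  assumes H: "submodule H RS L"
  shows "sat_submodule (contr H)"
proof -
  interpret H: submodule H RS L by (rule H)
  have sm: "fr (a \<odot>\<^bsub>M\<^esub> x) s \<in> H" if "a \<in> carrier R" "s \<in> S" "x \<in> contr H" for a x s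
  proof -
    have "fr\<^sub>R a s \<odot>\<^bsub>L\<^esub> fr x \<one> \<in> H"
      using that by (intro H.smult_closed[OF fr_carrier_RS]) (auto simp: contr_def)
    then show ?thesis using that S_one by (simp add: contr_def smult_fr)
  qed
  have "submodule (contr H) R M"
  proof (rule submoduleI)
    show "contr H \<subseteq> carrier M" by (auto simp: contr_def)
    show "\<zero>\<^bsub>M\<^esub> \<in> contr H" using H.one_closed by (simp add: contr_def zero_L[symmetric])
    fix x assume x: "x \<in> contr H"
    then have xc: "x \<in> carrier M" by (simp add: contr_def)
    show "\<ominus>\<^bsub>M\<^esub> x \<in> contr H" using sm[of "\<ominus> \<one>" \<one> x] x xc S_one by (simp add: contr_def smult_l_minus)
    show "a \<odot>\<^bsub>M\<^esub> x \<in> contr H" if "a \<in> carrier R" for a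
      using sm[of a \<one> x] x xc S_one that by (simp add: contr_def)
    fix y assume y: "y \<in> contr H"
    have "fr x \<one> \<oplus>\<^bsub>L\<^esub> fr y \<one> \<in> H" using H.m_closed[of "fr x \<one>" "fr y \<one>"] x y by (simp add: contr_def)
    then show "x \<oplus>\<^bsub>M\<^esub> y \<in> contr H" using x y S_one by (simp add: contr_def add_fr)
  qed
  moreover have "x \<in> contr H" if s: "s \<in> S" and x: "x \<in> carrier M" "s \<odot>\<^bsub>M\<^esub> x \<in> contr H" for s x
    using sm[of \<one> s "s \<odot>\<^bsub>M\<^esub> x"] fr_cancel[of x \<one> s] that S_one by (simp add: contr_def)
  ultimately show ?thesis by (auto simp: sat_submodule_def)
qed

lemma ext_contr:
  assumes H: "submodule H RS L"
  shows "ext (contr H) = H"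
proof
  interpret H: submodule H RS L by (rule H)
  show "ext (contr H) \<subseteq> H"
  proof
    fix y assume "y \<in> ext (contr H)"
    then obtain x s where y: "y = fr x s" "x \<in> carrier M" "fr x \<one> \<in> H" "s \<in> S" by (auto simp: ext_def contr_def)
    have "fr\<^sub>R \<one> s \<odot>\<^bsub>L\<^esub> fr x \<one> \<in> H" using H.smult_closed[OF fr_carrier_RS y(3)] y(4) by simp
    then show "y \<in> H" using y S_one by (simp add: smult_fr)
  qed
  show "H \<subseteq> ext (contr H)"
  proof
    fix y assume y: "y \<in> H"
    then have "y \<in> carrier L" using H.subset by auto
    then obtain x s where x: "y = fr x s" "x \<in> carrier M" "s \<in> S" by (auto simp: carrier_L)
    have "fr\<^sub>R s \<one> \<odot>\<^bsub>L\<^esub> y \<in> H" using H.smult_closed[OF fr_carrier_RS y] x(3) S_one by simp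
    then have "fr (s \<odot>\<^bsub>M\<^esub> x) s \<in> H" using x S_one by (simp add: smult_fr)
    moreover have "fr (s \<odot>\<^bsub>M\<^esub> x) s = fr x \<one>" using fr_cancel[of x \<one> s] x S_one by simp
    ultimately show "y \<in> ext (contr H)" using x by (simp add: fr_ext contr_def)
  qed
qed

lemma contr_ext:
  assumes N: "sat_submodule N"
  shows "contr (ext N) = N"
proof
  note Ns = sat_submoduleD(1)[OF N]
  note Nc = subsetD[OF submoduleE(1)[OF Ns]]
  show "N \<subseteq> contr (ext N)" using Nc S_one by (auto simp: contr_def intro: fr_ext)
  show "contr (ext N) \<subseteq> N"
  proof
    fix x assume "x \<in> contr (ext N)"
    then obtain y s where y: "x \<in> carrier M" "fr x \<one> = fr y s" "y \<in> N" "s \<in> S" by (auto simp: contr_def ext_def)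
    then obtain u where u: "u \<in> S" "(u \<otimes> s) \<odot>\<^bsub>M\<^esub> x = (u \<otimes> \<one>) \<odot>\<^bsub>M\<^esub> y" using fr_eq_iff[of x y \<one> s] S_one Nc by auto
    then have "(u \<otimes> s) \<odot>\<^bsub>M\<^esub> x \<in> N" using submoduleE(4)[OF Ns] y by simp
    then show "x \<in> N" using sat_submoduleD(2)[OF N] S_mult[OF u(1) y(4)] y(1) by blast
  qed
qed

lemma ext_mono: "N \<subseteq> N' \<Longrightarrow> ext N \<subseteq> ext N'" by (auto simp: ext_def)
lemma contr_mono: "H \<subseteq> H' \<Longrightarrow> contr H \<subseteq> contr H'" by (auto simp: contr_def)

text \<open>Contraction and extension are monotone and mutually inverse here, so strict chains go to
  strict chains of the same number of steps in both directions.\<close>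

lemma module_length_ext:
  assumes N: "sat_submodule N"
  shows "module_length RS (L\<lparr>carrier := ext N\<rparr>) = sat_length N"
proof -
  note sub = submodule_restrict_iff[OF abelian_group_L submodule_ext[OF sat_submoduleD(1)[OF N]]]
  have "(\<exists>H. (\<forall>i\<le>n. submodule (H i) RS (L\<lparr>carrier := ext N\<rparr>)) \<and> (\<forall>i<n. H i \<subset> H (Suc i))) \<longleftrightarrow> sat_chain N n" for n
  proof
    assume "\<exists>H. (\<forall>i\<le>n. submodule (H i) RS (L\<lparr>carrier := ext N\<rparr>)) \<and> (\<forall>i<n. H i \<subset> H (Suc i))"
    then obtain H where H': "\<forall>i\<le>n. submodule (H i) RS L \<and> H i \<subseteq> ext N" "\<forall>i<n. H i \<subset> H (Suc i)"
      unfolding sub by (elim exE conjE)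
    have H: "submodule (H i) RS L" "H i \<subseteq> ext N" if "i \<le> n" for i using H'(1) that by auto
    have H_strict: "H i \<subset> H (Suc i)" if "i < n" for i using H'(2) that by blast
    have "contr (H i) \<subset> contr (H (Suc i))" if i: "i < n" for i
    proof
      show "contr (H i) \<subseteq> contr (H (Suc i))" by (rule contr_mono[OF psubset_imp_subset[OF H_strict[OF i]]])
      show "contr (H i) \<noteq> contr (H (Suc i))"
      proof
        assume "contr (H i) = contr (H (Suc i))"
        then have "ext (contr (H i)) = ext (contr (H (Suc i)))" by (rule arg_cong)
        then have "H i = H (Suc i)"
          unfolding ext_contr[OF H(1)[OF less_imp_le[OF i]]] ext_contr[OF H(1)[OF Suc_leI[OF i]]] .
        then show False using H_strict[OF i] by simp
      qed
    qed
    moreover have "contr (H i) \<subseteq> N" if "i \<le> n" for i using contr_mono[OF H(2)[OF that]] contr_ext[OF N] by simp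
    moreover have "sat_submodule (contr (H i))" if "i \<le> n" for i by (rule sat_submodule_contr[OF H(1)[OF that]])
    ultimately show "sat_chain N n"
      unfolding sat_chain_def by (intro exI[of _ "\<lambda>i. contr (H i)"]) simp
  next
    assume "sat_chain N n"
    then obtain H where H': "\<forall>i\<le>n. sat_submodule (H i) \<and> H i \<subseteq> N" "\<forall>i<n. H i \<subset> H (Suc i)"
      unfolding sat_chain_def by (elim exE conjE)
    have H: "sat_submodule (H i)" "H i \<subseteq> N" if "i \<le> n" for i using H'(1) that by auto
    have H_strict: "H i \<subset> H (Suc i)" if "i < n" for i using H'(2) that by blast
    have "ext (H i) \<subset> ext (H (Suc i))" if i: "i < n" for i
    proof
      show "ext (H i) \<subseteq> ext (H (Suc i))" by (rule ext_mono[OF psubset_imp_subset[OF H_strict[OF i]]])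
      show "ext (H i) \<noteq> ext (H (Suc i))"
      proof
        assume "ext (H i) = ext (H (Suc i))"
        then have "contr (ext (H i)) = contr (ext (H (Suc i)))" by (rule arg_cong)
        then have "H i = H (Suc i)"
          unfolding contr_ext[OF H(1)[OF less_imp_le[OF i]]] contr_ext[OF H(1)[OF Suc_leI[OF i]]] .
        then show False using H_strict[OF i] by simp
      qed
    qed
    moreover have "submodule (ext (H i)) RS L" if "i \<le> n" for i
      by (rule submodule_ext[OF sat_submoduleD(1)[OF H(1)[OF that]]])
    moreover have "ext (H i) \<subseteq> ext N" if "i \<le> n" for i by (rule ext_mono[OF H(2)[OF that]])
    ultimately show "\<exists>H. (\<forall>i\<le>n. submodule (H i) RS (L\<lparr>carrier := ext N\<rparr>)) \<and> (\<forall>i<n. H i \<subset> H (Suc i))"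
      unfolding sub by (intro exI[of _ "\<lambda>i. ext (H i)"]) simp
  qed
  then show ?thesis unfolding module_length_def sat_length_def by simp
qed

text \<open>Evaluates the definite description in \<open>finlen\<close> from data inside
  \<open>M\<close>: a largest saturated submodule of finite length extends to the largest submodule
  of finite length of the localization.\<close>

lemma finlen_loc:
  assumes N: "sat_submodule N" and fin: "sat_length N < \<infinity>"
    and max: "\<And>K. \<lbrakk>sat_submodule K; sat_length K < \<infinity>\<rbrakk> \<Longrightarrow> K \<subseteq> N"
  shows "finlen RS L = the_enat (sat_length N)"
proof -
  have "largest_fl_submodule RS L (ext N)"
    unfolding largest_fl_submodule_def
  proof (intro conjI allI impI)
    show "submodule (ext N) RS L" by (rule submodule_ext[OF sat_submoduleD(1)[OF N]])
    show "module_length RS (L\<lparr>carrier := ext N\<rparr>) < \<infinity>" using fin by (simp add: module_length_ext[OF N])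
    fix K assume "submodule K RS L \<and> module_length RS (L\<lparr>carrier := K\<rparr>) < \<infinity>"
    then have K: "submodule K RS L" "module_length RS (L\<lparr>carrier := ext (contr K)\<rparr>) < \<infinity>" by (auto simp: ext_contr)
    then have "contr K \<subseteq> N" using max sat_submodule_contr module_length_ext by metis
    then show "K \<subseteq> ext N" using ext_mono ext_contr[OF K(1)] by blast
  qed
  then have "(THE H. largest_fl_submodule RS L H) = ext N"
    by (intro the_equality) (auto simp: largest_fl_submodule_def)
  then show ?thesis by (simp add: finlen_def module_length_ext[OF N])
qed

lemma sat_length_finite_iff: "sat_length N < \<infinity> \<longleftrightarrow> (\<exists>k. \<forall>n. sat_chain N n \<longrightarrow> n \<le> k)"
proof
  assume "sat_length N < \<infinity>"
  then obtain k where "sat_length N = enat k" by (cases "sat_length N") auto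
  then have "n \<le> k" if "sat_chain N n" for n
    using that Sup_upper[of "enat n" "{enat n | n. sat_chain N n}"] unfolding sat_length_def by auto
  then show "\<exists>k. \<forall>n. sat_chain N n \<longrightarrow> n \<le> k" by blast
next
  assume "\<exists>k. \<forall>n. sat_chain N n \<longrightarrow> n \<le> k"
  then obtain k where "\<And>n. sat_chain N n \<Longrightarrow> n \<le> k" by blast
  then have "sat_length N \<le> enat k" unfolding sat_length_def by (intro Sup_least) auto
  then show "sat_length N < \<infinity>" using enat_ord_simps(4) le_less_trans by blast
qed

text \<open>The contraction of the submodule of the localization generated by \<open>y / 1\<close>;
  equally, the saturation of \<open>R y\<close>.\<close>

definition cyc :: "'c \<Rightarrow> 'c set"
  where "cyc y = {z \<in> carrier M. \<exists>s\<in>S. \<exists>r\<in>carrier R. s \<odot>\<^bsub>M\<^esub> z = r \<odot>\<^bsub>M\<^esub> y}"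

text \<open>For a submodule \<open>N\<close>, the contraction of its extension, and the smallest
  saturated submodule containing it.\<close>

definition sat :: "'c set \<Rightarrow> 'c set"
  where "sat N = {z \<in> carrier M. \<exists>s\<in>S. s \<odot>\<^bsub>M\<^esub> z \<in> N}"

lemma sat_submodule_sat:
  assumes N: "submodule N R M"
  shows "sat_submodule (sat N)"
  unfolding sat_submodule_def
proof
  note NE = submoduleE[OF N]
  show "submodule (sat N) R M"
  proof (rule submoduleI)
    show "sat N \<subseteq> carrier M" by (auto simp: sat_def)
    show "\<zero>\<^bsub>M\<^esub> \<in> sat N" using S_one submodule_zero[OF N] by (auto simp: sat_def intro!: bexI[of _ \<one>])
    fix x assume "x \<in> sat N"
    then obtain s where x: "x \<in> carrier M" "s \<in> S" "s \<odot>\<^bsub>M\<^esub> x \<in> N" by (auto simp: sat_def)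
    show "\<ominus>\<^bsub>M\<^esub> x \<in> sat N" using x NE(3)[OF x(3)] by (auto simp: sat_def smult_r_minus intro!: bexI[of _ s])
    show "a \<odot>\<^bsub>M\<^esub> x \<in> sat N" if a: "a \<in> carrier R" for a
      using x a NE(4)[OF a x(3)] by (auto simp: sat_def smult_commute[of s a] intro!: bexI[of _ s])
    fix y assume "y \<in> sat N"
    then obtain t where y: "y \<in> carrier M" "t \<in> S" "t \<odot>\<^bsub>M\<^esub> y \<in> N" by (auto simp: sat_def)
    have "(s \<otimes> t) \<odot>\<^bsub>M\<^esub> (x \<oplus>\<^bsub>M\<^esub> y) = t \<odot>\<^bsub>M\<^esub> (s \<odot>\<^bsub>M\<^esub> x) \<oplus>\<^bsub>M\<^esub> s \<odot>\<^bsub>M\<^esub> (t \<odot>\<^bsub>M\<^esub> y)"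
      using x y by (simp add: smult_r_distr smult_assoc1 smult_commute[of s t])
    also have "\<dots> \<in> N" using x y NE(4,5) by simp
    finally show "x \<oplus>\<^bsub>M\<^esub> y \<in> sat N" using x y S_mult by (auto simp: sat_def)
  qed
  show "\<forall>s\<in>S. \<forall>x\<in>carrier M. s \<odot>\<^bsub>M\<^esub> x \<in> sat N \<longrightarrow> x \<in> sat N"
  proof (intro ballI impI)
    fix s x assume s: "s \<in> S" and x: "x \<in> carrier M" and "s \<odot>\<^bsub>M\<^esub> x \<in> sat N"
    then obtain t where "t \<in> S" "(t \<otimes> s) \<odot>\<^bsub>M\<^esub> x \<in> N" by (auto simp: sat_def smult_assoc1)
    then show "x \<in> sat N" using s x S_mult by (auto simp: sat_def)
  qed
qed

lemma sat_least: "\<lbrakk>sat_submodule K; N \<subseteq> K\<rbrakk> \<Longrightarrow> sat N \<subseteq> K"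
  by (auto simp: sat_def sat_submodule_def)

lemma sat_increasing: "submodule N R M \<Longrightarrow> N \<subseteq> sat N"
  using S_one submoduleE(1)[of N] by (auto simp: sat_def intro!: bexI[of _ \<one>])

lemma submodule_principal:
  assumes "y \<in> carrier M" shows "submodule {r \<odot>\<^bsub>M\<^esub> y | r. r \<in> carrier R} R M"
proof -
  have "{h \<oplus>\<^bsub>M\<^esub> r \<odot>\<^bsub>M\<^esub> y | h r. h \<in> {\<zero>\<^bsub>M\<^esub>} \<and> r \<in> carrier R} = {r \<odot>\<^bsub>M\<^esub> y | r. r \<in> carrier R}"
    using assms by auto force
  then show ?thesis using submodule_adjoin[OF submodule_zero_set assms] by simp
qed

lemma sat_submodule_cyc: "y \<in> carrier M \<Longrightarrow> sat_submodule (cyc y)"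
proof -
  assume y: "y \<in> carrier M"
  have "cyc y = sat {r \<odot>\<^bsub>M\<^esub> y | r. r \<in> carrier R}" by (auto simp: cyc_def sat_def)
  then show ?thesis using sat_submodule_sat[OF submodule_principal[OF y]] by simp
qed

lemma cyc_self: "y \<in> carrier M \<Longrightarrow> y \<in> cyc y"
  using S_one by (auto simp: cyc_def)

lemma cyc_least: "\<lbrakk>sat_submodule K; y \<in> K\<rbrakk> \<Longrightarrow> cyc y \<subseteq> K"
  using submoduleE(4)[of K _ y] by (auto simp: cyc_def sat_submodule_def)

lemma sat_submodule_Int: "\<lbrakk>sat_submodule H; sat_submodule K\<rbrakk> \<Longrightarrow> sat_submodule (H \<inter> K)"
  by (auto simp: sat_submodule_def submodule_Int)

end

section \<open>The largest submodule of finite length at a prime\<close>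

locale noetherian_module_prime = noetherian_module R M + P: primeideal p R
  for R (structure) and M (structure) and p

sublocale noetherian_module_prime \<subseteq> module_loc R M "carrier R - p"
  by unfold_locales (use P.one_compl P.compl_mult in auto)

context noetherian_module_prime
begin

text \<open>As a rewrite rule, its instance \<open>s \<in> carrier R - p \<Longrightarrow> s \<in> carrier R\<close> would loop.\<close>

declare S_closed [simp del]

abbreviation "T \<equiv> loc_tors R M p"

lemma T_carrier: "x \<in> T \<Longrightarrow> x \<in> carrier M"
  by (simp add: loc_tors_def)

lemma TD:
  assumes "x \<in> T" "a \<in> p"
  obtains n :: nat and s where "s \<in> carrier R - p" "(s \<otimes> a [^] n) \<odot>\<^bsub>M\<^esub> x = \<zero>\<^bsub>M\<^esub>"
proof -
  obtain n :: nat and s where "s \<in> carrier R - p" "s \<odot>\<^bsub>M\<^esub> (a [^] n \<odot>\<^bsub>M\<^esub> x) = \<zero>\<^bsub>M\<^esub>"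
    using assms unfolding loc_tors_def by blast
  then show ?thesis using that[of s n] assms(1) P.Icarr[OF assms(2)] T_carrier by (simp add: smult_assoc1)
qed

lemma TI:
  assumes "x \<in> carrier M"
    and "\<And>a. a \<in> p \<Longrightarrow> \<exists>n::nat. \<exists>s\<in>carrier R - p. (s \<otimes> a [^] n) \<odot>\<^bsub>M\<^esub> x = \<zero>\<^bsub>M\<^esub>"
  shows "x \<in> T"
  unfolding loc_tors_def
proof (intro CollectI conjI ballI)
  fix a assume a: "a \<in> p"
  note aR = P.Icarr[OF a]
  obtain n :: nat and s where "s \<in> carrier R - p" "(s \<otimes> a [^] n) \<odot>\<^bsub>M\<^esub> x = \<zero>\<^bsub>M\<^esub>"
    using assms(2)[OF a] by blast
  then show "\<exists>n::nat. \<exists>s\<in>carrier R - p. s \<odot>\<^bsub>M\<^esub> (a [^] n \<odot>\<^bsub>M\<^esub> x) = \<zero>\<^bsub>M\<^esub>"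
    using aR assms(1) by (intro exI[of _ n] bexI[of _ s]) (auto simp: smult_assoc1)
qed (rule assms(1))

lemma sat_submodule_T: "sat_submodule T"
  unfolding sat_submodule_def
proof
  have closed: "a \<odot>\<^bsub>M\<^esub> x \<in> T" if a: "a \<in> carrier R" and x: "x \<in> T" for a x
  proof (rule TI)
    show "a \<odot>\<^bsub>M\<^esub> x \<in> carrier M" using a T_carrier[OF x] by simp
    fix b assume b: "b \<in> p"
    obtain n :: nat and s where s: "s \<in> carrier R - p" "(s \<otimes> b [^] n) \<odot>\<^bsub>M\<^esub> x = \<zero>\<^bsub>M\<^esub>" by (rule TD[OF x b])
    have "(s \<otimes> b [^] n) \<odot>\<^bsub>M\<^esub> (a \<odot>\<^bsub>M\<^esub> x) = a \<odot>\<^bsub>M\<^esub> ((s \<otimes> b [^] n) \<odot>\<^bsub>M\<^esub> x)"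
      using s(1) a P.Icarr[OF b] T_carrier[OF x] by (intro smult_commute) auto
    then show "\<exists>n::nat. \<exists>s\<in>carrier R - p. (s \<otimes> b [^] n) \<odot>\<^bsub>M\<^esub> (a \<odot>\<^bsub>M\<^esub> x) = \<zero>\<^bsub>M\<^esub>"
      using s a by auto
  qed
  show "submodule T R M"
  proof (rule submoduleI)
    show "T \<subseteq> carrier M" using T_carrier by auto
    show "\<zero>\<^bsub>M\<^esub> \<in> T" using P.one_compl by (intro TI) auto
    fix x assume x: "x \<in> T"
    show "\<ominus>\<^bsub>M\<^esub> x \<in> T" using closed[of "\<ominus> \<one>" x] x T_carrier[OF x] by (simp add: smult_l_minus)
    show "a \<odot>\<^bsub>M\<^esub> x \<in> T" if "a \<in> carrier R" for a by (rule closed[OF that x])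
    fix y assume y: "y \<in> T"
    note xy = T_carrier[OF x] T_carrier[OF y]
    show "x \<oplus>\<^bsub>M\<^esub> y \<in> T"
    proof (rule TI)
      show "x \<oplus>\<^bsub>M\<^esub> y \<in> carrier M" using xy by simp
      fix a assume a: "a \<in> p"
      note aR = P.Icarr[OF a]
      obtain n :: nat and s where s: "s \<in> carrier R - p" "(s \<otimes> a [^] n) \<odot>\<^bsub>M\<^esub> x = \<zero>\<^bsub>M\<^esub>" by (rule TD[OF x a])
      obtain k :: nat and t where t: "t \<in> carrier R - p" "(t \<otimes> a [^] k) \<odot>\<^bsub>M\<^esub> y = \<zero>\<^bsub>M\<^esub>" by (rule TD[OF y a])
      have pow: "a [^] (n + k) = a [^] n \<otimes> a [^] k" using aR by (simp add: R.nat_pow_mult)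
      have "((s \<otimes> t) \<otimes> a [^] (n + k)) \<odot>\<^bsub>M\<^esub> (x \<oplus>\<^bsub>M\<^esub> y) =
          (t \<otimes> a [^] k) \<odot>\<^bsub>M\<^esub> ((s \<otimes> a [^] n) \<odot>\<^bsub>M\<^esub> x) \<oplus>\<^bsub>M\<^esub> (s \<otimes> a [^] n) \<odot>\<^bsub>M\<^esub> ((t \<otimes> a [^] k) \<odot>\<^bsub>M\<^esub> y)"
        unfolding pow using s(1) t(1) aR xy
        by (simp add: smult_r_distr smult_assoc1[symmetric] R.m_ac)
      also have "\<dots> = \<zero>\<^bsub>M\<^esub>" using s t aR by simp
      finally show "\<exists>n::nat. \<exists>s\<in>carrier R - p. (s \<otimes> a [^] n) \<odot>\<^bsub>M\<^esub> (x \<oplus>\<^bsub>M\<^esub> y) = \<zero>\<^bsub>M\<^esub>"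
        using P.compl_mult[OF s(1) t(1)] by blast
    qed
  qed
  show "\<forall>s\<in>carrier R - p. \<forall>x\<in>carrier M. s \<odot>\<^bsub>M\<^esub> x \<in> T \<longrightarrow> x \<in> T"
  proof (intro ballI impI)
    fix s x assume s: "s \<in> carrier R - p" and x: "x \<in> carrier M" "s \<odot>\<^bsub>M\<^esub> x \<in> T"
    show "x \<in> T"
    proof (rule TI)
      fix a assume a: "a \<in> p"
      note aR = P.Icarr[OF a]
      obtain n :: nat and t where t: "t \<in> carrier R - p" "(t \<otimes> a [^] n) \<odot>\<^bsub>M\<^esub> (s \<odot>\<^bsub>M\<^esub> x) = \<zero>\<^bsub>M\<^esub>"
        by (rule TD[OF x(2) a])
      have "((s \<otimes> t) \<otimes> a [^] n) \<odot>\<^bsub>M\<^esub> x = (t \<otimes> a [^] n) \<odot>\<^bsub>M\<^esub> (s \<odot>\<^bsub>M\<^esub> x)"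
        using s t(1) aR x(1) by (simp add: smult_assoc1[symmetric] R.m_ac)
      then show "\<exists>n::nat. \<exists>s\<in>carrier R - p. (s \<otimes> a [^] n) \<odot>\<^bsub>M\<^esub> x = \<zero>\<^bsub>M\<^esub>"
        using P.compl_mult[OF s t(1)] t(2) by metis
    qed (rule x)
  qed
qed

text \<open>
  If no \<open>s a\<^sup>n\<close> kills \<open>x\<close>, then the saturations of \<open>R a\<^sup>n x\<close> form an infinite strictly descending chain.
\<close>

lemma finite_sat_length_subset_T:
  assumes N: "sat_submodule N" and fin: "sat_length N < \<infinity>"
  shows "N \<subseteq> T"
proof
  fix x assume x: "x \<in> N"
  note Ns = sat_submoduleD(1)[OF N]
  have xM: "x \<in> carrier M" using x submoduleE(1)[OF Ns] by auto
  obtain k where k: "\<And>n. sat_chain N n \<Longrightarrow> n \<le> k" using fin sat_length_finite_iff by blast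
  show "x \<in> T"
  proof (rule TI[OF xM], rule ccontr)
    fix a assume a: "a \<in> p" and neg: "\<not> (\<exists>n::nat. \<exists>s\<in>carrier R - p. (s \<otimes> a [^] n) \<odot>\<^bsub>M\<^esub> x = \<zero>\<^bsub>M\<^esub>)"
    note aR = P.Icarr[OF a]
    define y where "y = (\<lambda>j::nat. a [^] j \<odot>\<^bsub>M\<^esub> x)"
    have yM: "y j \<in> carrier M" for j using aR xM by (simp add: y_def)
    have yN: "y j \<in> N" for j using aR x submoduleE(4)[OF Ns] by (simp add: y_def)
    have y_Suc: "y (Suc j) = a \<odot>\<^bsub>M\<^esub> y j" for j
      using aR xM smult_commute[of "a [^] j" a x] by (simp add: y_def smult_assoc1)
    have sub: "cyc (y (Suc j)) \<subseteq> cyc (y j)" for j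
      using cyc_self[OF yM, of j] submoduleE(4)[OF sat_submoduleD(1)[OF sat_submodule_cyc[OF yM]], of a "y j" j] aR
      by (intro cyc_least[OF sat_submodule_cyc[OF yM]]) (simp add: y_Suc)
    have "y j \<notin> cyc (y (Suc j))" for j
    proof
      assume "y j \<in> cyc (y (Suc j))"
      then obtain s r where sr: "s \<in> carrier R - p" "r \<in> carrier R" "s \<odot>\<^bsub>M\<^esub> y j = r \<odot>\<^bsub>M\<^esub> (a \<odot>\<^bsub>M\<^esub> y j)"
        unfolding cyc_def y_Suc by blast
      have ra: "r \<otimes> a \<in> p" using a sr P.I_l_closed by simp
      \<comment> \<open>The argument of Nakayama's lemma: \<open>s - r a\<close> is a unit at
        \<open>p\<close> and kills \<open>y j\<close>, so \<open>(s - r a) a^j\<close> kills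
        \<open>x\<close>, which \<open>neg\<close> forbids.\<close>
      have "s \<ominus> r \<otimes> a \<notin> p"
      proof
        assume "s \<ominus> r \<otimes> a \<in> p"
        then have "(s \<ominus> r \<otimes> a) \<oplus> r \<otimes> a \<in> p" using ra by (rule P.a_closed)
        then show False using sr aR by (simp add: R.minus_eq R.a_assoc R.l_neg)
      qed
      moreover have "((s \<ominus> r \<otimes> a) \<otimes> a [^] j) \<odot>\<^bsub>M\<^esub> x = (s \<ominus> r \<otimes> a) \<odot>\<^bsub>M\<^esub> y j"
        using sr(1,2) aR xM by (simp add: y_def smult_assoc1)
      moreover have "(s \<ominus> r \<otimes> a) \<odot>\<^bsub>M\<^esub> y j = \<zero>\<^bsub>M\<^esub>"
        using sr aR yM[of j] by (simp add: R.minus_eq smult_l_distr smult_l_minus smult_assoc1 M.r_neg)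
      ultimately show False using neg sr(1,2) aR by auto
    qed
    then have strict: "cyc (y (Suc j)) \<subset> cyc (y j)" for j using sub cyc_self[OF yM, of j] by blast
    \<comment> \<open>The submodules \<open>cyc (y j)\<close> descend while \<open>sat_chain\<close>
      ascends, so the index is reversed. \<open>Suc k\<close> steps exceed the bound
      \<open>k\<close>.\<close>
    have "sat_chain N (Suc k)"
      unfolding sat_chain_def
    proof (intro exI[of _ "\<lambda>i. cyc (y (Suc k - i))"] conjI allI impI)
      fix i show "sat_submodule (cyc (y (Suc k - i)))" by (rule sat_submodule_cyc[OF yM])
      show "cyc (y (Suc k - i)) \<subseteq> N" by (rule cyc_least[OF N yN])
    next
      fix i assume "i < Suc k"
      then have "Suc k - i = Suc (Suc k - Suc i)" by simp
      then show "cyc (y (Suc k - i)) \<subset> cyc (y (Suc k - Suc i))" using strict by metis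
    qed
    then show False using k by fastforce
  qed
qed

text \<open>As \<open>p y\<close> lies in \<open>N\<close>, the quotient of \<open>N + R y\<close>
  by \<open>N\<close> becomes, at \<open>p\<close>, a quotient of the residue field, so it has
  length at most one. Chains in the saturation of \<open>N + R y\<close> are therefore at most one
  step longer than chains in \<open>N\<close>.\<close>

lemma sat_chain_adjoin:
  assumes N: "sat_submodule N" and y: "y \<in> carrier M" and py: "\<And>a. a \<in> p \<Longrightarrow> a \<odot>\<^bsub>M\<^esub> y \<in> N"
    and chain: "sat_chain (sat {h \<oplus>\<^bsub>M\<^esub> r \<odot>\<^bsub>M\<^esub> y | h r. h \<in> N \<and> r \<in> carrier R}) (Suc n)"
  shows "sat_chain N n"
proof -
  let ?K = "sat {h \<oplus>\<^bsub>M\<^esub> r \<odot>\<^bsub>M\<^esub> y | h r. h \<in> N \<and> r \<in> carrier R}"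
  note Ns = sat_submoduleD(1)[OF N]
  note Nc = subsetD[OF submoduleE(1)[OF Ns]]
  obtain H where H': "\<forall>i\<le>Suc n. sat_submodule (H i) \<and> H i \<subseteq> ?K" "\<forall>i<Suc n. H i \<subset> H (Suc i)"
    using chain unfolding sat_chain_def by (elim exE conjE)
  have H: "sat_submodule (H i)" "H i \<subseteq> ?K" if "i \<le> Suc n" for i using H'(1) that by auto
  have H_strict: "H i \<subset> H (Suc i)" if "i < Suc n" for i using H'(2) that by blast
  \<comment> \<open>Once \<open>H i\<close> has an element \<open>l\<close> outside
    \<open>N\<close>, its coefficient of \<open>y\<close> is a unit at \<open>p\<close>, so any
    \<open>x\<close> in the next member can be corrected by a multiple of \<open>l\<close> to land
    in \<open>N\<close>. Equal intersections with \<open>N\<close> would then put \<open>x\<close>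
    into \<open>H i\<close>.\<close>
  have step: "H i \<inter> N \<subset> H (Suc i) \<inter> N" if i: "i < Suc n" and HN: "\<not> H i \<subseteq> N" for i
  proof
    show "H i \<inter> N \<subseteq> H (Suc i) \<inter> N" using H_strict[OF i] by blast
    have Hi: "sat_submodule (H i)" "H i \<subseteq> ?K" and HS: "sat_submodule (H (Suc i))" "H (Suc i) \<subseteq> ?K"
      using H[of i] H[of "Suc i"] i by auto
    note Hs = sat_submoduleD(1)[OF Hi(1)] sat_submoduleD(1)[OF HS(1)]
    obtain l where l: "l \<in> H i" "l \<notin> N" using HN by auto
    then obtain s h r where s: "s \<in> carrier R - p" "h \<in> N" "r \<in> carrier R" "s \<odot>\<^bsub>M\<^esub> l = h \<oplus>\<^bsub>M\<^esub> r \<odot>\<^bsub>M\<^esub> y" "l \<in> carrier M"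
      using Hi(2) unfolding sat_def by blast
    have r: "r \<in> carrier R - p"
    proof (rule ccontr)
      assume "r \<notin> carrier R - p"
      then have "s \<odot>\<^bsub>M\<^esub> l \<in> N" using s py submoduleE(5)[OF Ns] by auto
      then show False using sat_submoduleD(2)[OF N s(1,5)] l by blast
    qed
    show "H i \<inter> N \<noteq> H (Suc i) \<inter> N"
    proof
      assume eq: "H i \<inter> N = H (Suc i) \<inter> N"
      have "H (Suc i) \<subseteq> H i"
      proof
        fix x assume x: "x \<in> H (Suc i)"
        then obtain t h' r' where t: "t \<in> carrier R - p" "h' \<in> N" "r' \<in> carrier R" "x \<in> carrier M"
          "t \<odot>\<^bsub>M\<^esub> x = h' \<oplus>\<^bsub>M\<^esub> r' \<odot>\<^bsub>M\<^esub> y" using HS(2) unfolding sat_def by blast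
        \<comment> \<open>Cross-multiplication by the coefficients \<open>r\<close> and
          \<open>r'\<close> cancels the terms in \<open>y\<close>.\<close>
        let ?z = "r \<odot>\<^bsub>M\<^esub> (t \<odot>\<^bsub>M\<^esub> x) \<ominus>\<^bsub>M\<^esub> r' \<odot>\<^bsub>M\<^esub> (s \<odot>\<^bsub>M\<^esub> l)"
        have "?z = r \<odot>\<^bsub>M\<^esub> h' \<ominus>\<^bsub>M\<^esub> r' \<odot>\<^bsub>M\<^esub> h"
          unfolding s(4) t(5) using s(2,3) t(2,3) y Nc
          by (simp add: smult_r_distr smult_commute[of r' r] M.minus_eq M.minus_add M.a_ac M.r_neg M.r_neg1 M.r_neg2)
        then have "?z \<in> N" using submodule_minus[OF Ns] submoduleE(4)[OF Ns] s(2,3) t(2,3) by simp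
        moreover have "?z \<in> H (Suc i)"
          using submodule_minus[OF Hs(2)] submoduleE(4)[OF Hs(2)] s(1,3) t(1,3) x l(1) H_strict[OF i] by auto
        ultimately have "?z \<in> H i" using eq by blast
        moreover have "r' \<odot>\<^bsub>M\<^esub> (s \<odot>\<^bsub>M\<^esub> l) \<in> H i" using submoduleE(4)[OF Hs(1)] s(1) t(3) l(1) by simp
        ultimately have "?z \<oplus>\<^bsub>M\<^esub> r' \<odot>\<^bsub>M\<^esub> (s \<odot>\<^bsub>M\<^esub> l) \<in> H i" by (rule submoduleE(5)[OF Hs(1)])
        also have "?z \<oplus>\<^bsub>M\<^esub> r' \<odot>\<^bsub>M\<^esub> (s \<odot>\<^bsub>M\<^esub> l) = (r \<otimes> t) \<odot>\<^bsub>M\<^esub> x"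
          using s(1,3,5) t(1,3,4) by (simp add: M.minus_eq M.a_assoc M.l_neg smult_assoc1)
        finally show "x \<in> H i" using sat_submoduleD(2)[OF Hi(1) P.compl_mult[OF r t(1)] t(4)] by blast
      qed
      then show False using H_strict[OF i] by blast
    qed
  qed
  text \<open>
    Intersecting the chain with \<open>N\<close> can collapse at most one step, the one where the chain leaves \<open>N\<close>;
    \<open>G\<close> skips the member after this step.
  \<close>
  define G where "G = (\<lambda>i. if H (Suc i) \<subseteq> N then H i else H (Suc i) \<inter> N)"
  have G_Suc: "G i \<subset> G (Suc i)" if i: "i < n" for i
  proof (cases "H (Suc i) \<subseteq> N")
    case True
    have 1: "H i \<subset> H (Suc i)" "H (Suc i) \<subset> H (Suc (Suc i))" using H_strict i by auto
    then have "G i = H i" "H (Suc i) \<subseteq> G (Suc i)" using True by (auto simp: G_def)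
    then show ?thesis using 1 by blast
  next
    case False
    then have "\<not> H (Suc (Suc i)) \<subseteq> N" using H_strict[of "Suc i"] i by blast
    then show ?thesis using step[of "Suc i"] False i by (simp add: G_def)
  qed
  have "sat_submodule (G i) \<and> G i \<subseteq> N" if "i \<le> n" for i
  proof (cases "H (Suc i) \<subseteq> N")
    case True
    then show ?thesis using H(1)[of i] H_strict[of i] that by (auto simp: G_def)
  next
    case False
    then show ?thesis using sat_submodule_Int[OF H(1)[of "Suc i"] N] that by (simp add: G_def)
  qed
  then show ?thesis using G_Suc unfolding sat_chain_def by (intro exI[of _ G]) simp
qed

text \<open>
  A maximal saturated \<open>N \<subseteq> T\<close> of finite length is all of \<open>T\<close>: otherwise choose \<open>y \<in> T - N\<close> with maximal
  \<open>(N : y)\<close>; then \<open>p y \<subseteq> N\<close>, and adjoining \<open>y\<close> to \<open>N\<close> increases the length by at most one.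
\<close>

lemma sat_length_T_finite: "sat_length T < \<infinity>"
proof -
  let ?Q = "{N. sat_submodule N \<and> N \<subseteq> T \<and> sat_length N < \<infinity>}"
  have zero: "cyc \<zero>\<^bsub>M\<^esub> \<subseteq> N" if "sat_submodule N" for N
    using cyc_least[OF that] submodule_zero[OF sat_submoduleD(1)[OF that]] by blast
  \<comment> \<open>The set \<open>cyc \<zero>\<close> is contained in every saturated submodule, so
    no strict step fits inside it; it starts the search for a maximal \<open>N\<close>.\<close>
  have "n \<le> 0" if chain: "sat_chain (cyc \<zero>\<^bsub>M\<^esub>) n" for n
  proof (rule ccontr)
    assume "\<not> n \<le> 0"
    then have n: "0 < n" "Suc 0 \<le> n" by auto
    obtain H where H: "\<forall>i\<le>n. sat_submodule (H i) \<and> H i \<subseteq> cyc \<zero>\<^bsub>M\<^esub>" "\<forall>i<n. H i \<subset> H (Suc i)"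
      using chain unfolding sat_chain_def by (elim exE conjE)
    have "sat_submodule (H 0)" "H 0 \<subset> H (Suc 0)" "H (Suc 0) \<subseteq> cyc \<zero>\<^bsub>M\<^esub>" using H n by auto
    then show False using zero by blast
  qed
  then have "cyc \<zero>\<^bsub>M\<^esub> \<in> ?Q"
    using sat_submodule_cyc[of "\<zero>\<^bsub>M\<^esub>"] zero[OF sat_submodule_T] sat_length_finite_iff by blast
  from wf_minimal[OF wf_submodules this]
  obtain N where N': "N \<in> ?Q"
    "\<forall>K. (K, N) \<in> {(K, H). submodule H R M \<and> submodule K R M \<and> H \<subset> K} \<longrightarrow> K \<notin> ?Q"
    by (elim exE conjE)
  then have N: "sat_submodule N" "N \<subseteq> T" "sat_length N < \<infinity>" by auto
  note Ns = sat_submoduleD(1)[OF N(1)]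
  have "T \<subseteq> N"
  proof (rule ccontr)
    assume "\<not> T \<subseteq> N"
    then obtain x where x: "x \<in> T - N" by auto
    define C where "C = (\<lambda>x. {r \<in> carrier R. r \<odot>\<^bsub>M\<^esub> x \<in> N})"
    have "C x \<in> {C x | x. x \<in> T - N}" using x by blast
    from wf_minimal[OF noetherian_ring.wf_ideals[OF noetherian_ring] this]
    obtain I where I: "I \<in> {C x | x. x \<in> T - N}"
      "\<forall>J. (J, I) \<in> {(J, I). ideal I R \<and> ideal J R \<and> I \<subset> J} \<longrightarrow> J \<notin> {C x | x. x \<in> T - N}"
      by (elim exE conjE)
    then obtain y where y: "y \<in> T" "y \<notin> N" "I = C y" by auto
    note yM = T_carrier[OF y(1)]
    have py: "a \<odot>\<^bsub>M\<^esub> y \<in> N" if a: "a \<in> p" for a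
    proof (rule ccontr)
      note aR = P.Icarr[OF a]
      assume "a \<odot>\<^bsub>M\<^esub> y \<notin> N"
      then have ay: "a \<odot>\<^bsub>M\<^esub> y \<in> T - N"
        using submoduleE(4)[OF sat_submoduleD(1)[OF sat_submodule_T], of a y] aR y(1) by simp
      have "C y \<subseteq> C (a \<odot>\<^bsub>M\<^esub> y)"
        using aR yM submoduleE(4)[OF Ns, of a] by (auto simp: C_def smult_commute[of _ a])
      moreover have "ideal (C y) R" "ideal (C (a \<odot>\<^bsub>M\<^esub> y)) R"
        using ideal_colon[OF Ns] yM aR by (auto simp: C_def)
      moreover have "C (a \<odot>\<^bsub>M\<^esub> y) \<in> {C x | x. x \<in> T - N}" using ay by blast
      ultimately have eq: "C (a \<odot>\<^bsub>M\<^esub> y) = C y" using I(2) y(3) by blast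
      obtain n :: nat and s where s: "s \<in> carrier R - p" "(s \<otimes> a [^] n) \<odot>\<^bsub>M\<^esub> y = \<zero>\<^bsub>M\<^esub>" by (rule TD[OF y(1) a])
      then have "s \<otimes> a [^] n \<in> C y" using submodule_zero[OF Ns] aR by (simp add: C_def)
      \<comment> \<open>As \<open>C (a y) = C y\<close> by maximality, the factors \<open>a\<close>
        can be stripped off one at a time. What remains is \<open>s y\<close> in \<open>N\<close>,
        hence \<open>y\<close> in \<open>N\<close> by saturation.\<close>
      then have "s \<in> C y"
      proof (induction n)
        case (Suc n)
        have sR: "s \<in> carrier R" using s(1) by simp
        have "(s \<otimes> a [^] n) \<odot>\<^bsub>M\<^esub> (a \<odot>\<^bsub>M\<^esub> y) = (s \<otimes> a [^] Suc n) \<odot>\<^bsub>M\<^esub> y"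
          using sR aR yM by (simp add: smult_assoc1)
        also have "\<dots> \<in> N" using Suc.prems unfolding C_def by blast
        finally have "s \<otimes> a [^] n \<in> C (a \<odot>\<^bsub>M\<^esub> y)" using sR aR unfolding C_def by blast
        then show ?case unfolding eq by (rule Suc.IH)
      next
        case 0
        then show ?case using s(1) by simp
      qed
      then show False using sat_submoduleD(2)[OF N(1) s(1) yM] y(2) by (simp add: C_def)
    qed
    let ?A = "{h \<oplus>\<^bsub>M\<^esub> r \<odot>\<^bsub>M\<^esub> y | h r. h \<in> N \<and> r \<in> carrier R}"
    have As: "submodule ?A R M" by (rule submodule_adjoin[OF Ns yM])
    have sK: "sat_submodule (sat ?A)" by (rule sat_submodule_sat[OF As])
    have "sat ?A \<subseteq> T"
    proof (rule sat_least[OF sat_submodule_T])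
      show "?A \<subseteq> T" using N(2) y(1) submoduleE(4,5)[OF sat_submoduleD(1)[OF sat_submodule_T]] by blast
    qed
    moreover have "sat_length (sat ?A) < \<infinity>"
    proof -
      obtain k where k: "\<And>n. sat_chain N n \<Longrightarrow> n \<le> k" using N(3) sat_length_finite_iff by blast
      have "n \<le> Suc k" if "sat_chain (sat ?A) n" for n
        using that k sat_chain_adjoin[OF N(1) yM py] by (cases n) auto
      then show ?thesis using sat_length_finite_iff by blast
    qed
    moreover have "N \<subset> sat ?A"
    proof
      have "n = n \<oplus>\<^bsub>M\<^esub> \<zero> \<odot>\<^bsub>M\<^esub> y" if "n \<in> N" for n using submoduleE(1)[OF Ns] that yM by auto
      then have "N \<subseteq> ?A" by blast
      then show "N \<subseteq> sat ?A" using sat_increasing[OF As] by blast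
      have "y = \<zero>\<^bsub>M\<^esub> \<oplus>\<^bsub>M\<^esub> \<one> \<odot>\<^bsub>M\<^esub> y" using yM by simp
      then have "y \<in> ?A" using submodule_zero[OF Ns] R.one_closed by blast
      then show "N \<noteq> sat ?A" using y(2) sat_increasing[OF As] by blast
    qed
    ultimately show False using N'(2) sK Ns sat_submoduleD(1)[OF sK] by blast
  qed
  then show ?thesis using N by (simp add: subset_antisym)
qed

lemma finlen_at_eq: "finlen_at R M p = the_enat (sat_length T)"
  unfolding finlen_at_def
  by (rule finlen_loc[OF sat_submodule_T sat_length_T_finite finite_sat_length_subset_T])

lemma zero_psubset_cyc:
  assumes m: "m \<in> carrier M" "ann R M m = p"
  shows "cyc \<zero>\<^bsub>M\<^esub> \<subset> cyc m"
proof
  show "cyc \<zero>\<^bsub>M\<^esub> \<subseteq> cyc m"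
    using cyc_least[OF sat_submodule_cyc[OF m(1)]] submodule_zero[OF sat_submoduleD(1)[OF sat_submodule_cyc[OF m(1)]]]
    by blast
  have "m \<notin> cyc \<zero>\<^bsub>M\<^esub>" using m by (auto simp: cyc_def ann_iff)
  then show "cyc \<zero>\<^bsub>M\<^esub> \<noteq> cyc m" using cyc_self[OF m(1)] by blast
qed

text \<open>Since \<open>p\<close> is associated, \<open>T\<close> is nonzero at \<open>p\<close>
  and its length is at least one. Length one means that there is nothing strictly between zero and
  \<open>T\<close>, so any \<open>m\<close> with annihilator \<open>p\<close> generates
  \<open>T\<close> up to denominators, and conversely.\<close>

lemma finlen_eq_1_iff:
  assumes p: "p \<in> Ass R M"
  shows "finlen_at R M p = 1 \<longleftrightarrow> rank_one_tors R M p"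
proof
  obtain k where k: "sat_length T = enat k" using sat_length_T_finite by (cases "sat_length T") auto
  have chain_le: "n \<le> k" if "sat_chain T n" for n
    using that Sup_upper[of "enat n" "{enat n | n. sat_chain T n}"] k unfolding sat_length_def by auto
  { assume "finlen_at R M p = 1"
    then have k1: "k = 1" using k finlen_at_eq by simp
    show "rank_one_tors R M p"
      unfolding rank_one_tors_def
    proof (intro ballI impI)
      fix m x assume m: "m \<in> carrier M" "ann R M m = p" and x: "x \<in> T"
      have mT: "m \<in> T" using ann_loc_tors[OF m P.primeideal_axioms] .
      have "x \<in> cyc m"
      proof (rule ccontr)
        assume "x \<notin> cyc m"
        then have "cyc m \<subset> T" using cyc_least[OF sat_submodule_T mT] x by blast
        \<comment> \<open>The chain from \<open>cyc \<zero>\<close> through \<open>cyc m\<close> to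
          \<open>T\<close> has two strict steps.\<close>
        then have "sat_chain T 2"
          unfolding sat_chain_def
          using zero_psubset_cyc[OF m] sat_submodule_cyc[of "\<zero>\<^bsub>M\<^esub>"] sat_submodule_cyc[OF m(1)] sat_submodule_T
          by (intro exI[of _ "\<lambda>i. if i = 0 then cyc \<zero>\<^bsub>M\<^esub> else if i = 1 then cyc m else T"])
            (auto simp: less_Suc_eq numeral_2_eq_2)
        then show False using chain_le k1 by fastforce
      qed
      then show "\<exists>s\<in>carrier R - p. \<exists>r\<in>carrier R. s \<odot>\<^bsub>M\<^esub> x = r \<odot>\<^bsub>M\<^esub> m" by (simp add: cyc_def)
    qed }
  { assume r1: "rank_one_tors R M p"
    obtain m where m: "m \<in> carrier M" "ann R M m = p" using p by (auto simp: Ass_eq)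
    have mT: "m \<in> T" using ann_loc_tors[OF m P.primeideal_axioms] .
    have "cyc \<zero>\<^bsub>M\<^esub> \<subset> T" using zero_psubset_cyc[OF m] cyc_least[OF sat_submodule_T mT] by blast
    then have "sat_chain T 1"
      unfolding sat_chain_def using sat_submodule_cyc[of "\<zero>\<^bsub>M\<^esub>"] sat_submodule_T
      by (intro exI[of _ "\<lambda>i. if i = 0 then cyc \<zero>\<^bsub>M\<^esub> else T"]) auto
    then have "1 \<le> k" by (rule chain_le)
    have "n \<le> 1" if chain: "sat_chain T n" for n
    proof (rule ccontr)
      assume "\<not> n \<le> 1"
      obtain H where H': "\<forall>i\<le>n. sat_submodule (H i) \<and> H i \<subseteq> T" "\<forall>i<n. H i \<subset> H (Suc i)"
        using chain unfolding sat_chain_def by (elim exE conjE)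
      have H: "H 0 \<subset> H 1" "H 1 \<subset> H 2" "H 2 \<subseteq> T" "sat_submodule (H 0)" "sat_submodule (H 1)"
        using H' \<open>\<not> n \<le> 1\<close> by (auto simp: numeral_2_eq_2)
      obtain y where y: "y \<in> H 1" "y \<notin> H 0" using H by blast
      obtain z where z: "z \<in> H 2" "z \<notin> H 1" using H by blast
      have T: "y \<in> T" "z \<in> T" using y z H by auto
      note yz = T_carrier[OF T(1)] T_carrier[OF T(2)]
      obtain s r where s: "s \<in> carrier R - p" "r \<in> carrier R" "s \<odot>\<^bsub>M\<^esub> y = r \<odot>\<^bsub>M\<^esub> m"
        using r1 m T(1) unfolding rank_one_tors_def by blast
      obtain t q where t: "t \<in> carrier R - p" "q \<in> carrier R" "t \<odot>\<^bsub>M\<^esub> z = q \<odot>\<^bsub>M\<^esub> m"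
        using r1 m T(2) unfolding rank_one_tors_def by blast
      \<comment> \<open>Otherwise \<open>r m = 0\<close>, and \<open>y\<close> would be zero at
        \<open>p\<close> and thus belong to every saturated submodule.\<close>
      have r: "r \<in> carrier R - p"
      proof (rule ccontr)
        assume "r \<notin> carrier R - p"
        then have "s \<odot>\<^bsub>M\<^esub> y = \<zero>\<^bsub>M\<^esub>" using s m by (auto simp: ann_iff)
        then have "y \<in> H 0"
          using sat_submoduleD(2)[OF H(4) s(1) yz(1)] submodule_zero[OF sat_submoduleD(1)[OF H(4)]] by simp
        then show False using y by blast
      qed
      \<comment> \<open>With \<open>r\<close> a unit at \<open>p\<close>, the element
        \<open>y\<close> generates \<open>m\<close> and hence \<open>z\<close> there, so the chain
        cannot grow beyond \<open>H 1\<close>.\<close>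
      have "(r \<otimes> t) \<odot>\<^bsub>M\<^esub> z = q \<odot>\<^bsub>M\<^esub> (r \<odot>\<^bsub>M\<^esub> m)"
        using r t m yz smult_commute[of r q m] by (simp add: smult_assoc1)
      also have "\<dots> = q \<odot>\<^bsub>M\<^esub> (s \<odot>\<^bsub>M\<^esub> y)" by (simp add: s)
      also have "\<dots> \<in> H 1" using submoduleE(4)[OF sat_submoduleD(1)[OF H(5)]] t(2) s(1) y(1) by simp
      finally have "z \<in> H 1" using sat_submoduleD(2)[OF H(5) P.compl_mult[OF r t(1)] yz(2)] by blast
      then show False using z by blast
    qed
    then have "sat_length T \<le> enat 1" unfolding sat_length_def by (intro Sup_least) auto
    then show "finlen_at R M p = 1" using k \<open>1 \<le> k\<close> finlen_at_eq by simp }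
qed

end

section \<open>Length and open submodules of binary modules\<close>

lemma (in noetherian_module) finlen_at_eq_1_iff:
  assumes "p \<in> Ass R M"
  shows "finlen_at R M p = 1 \<longleftrightarrow> rank_one_tors R M p"
proof -
  interpret noetherian_module_prime R M p
    using assms by (intro noetherian_module_prime.intro noetherian_module_axioms) (auto simp: Ass_eq)
  show ?thesis by (rule finlen_eq_1_iff[OF assms])
qed

lemma (in noetherian_module) noetherian_submodule:
  assumes "submodule H R M"
  shows "noetherian_module R (M\<lparr>carrier := H\<rparr>)"
proof (intro noetherian_module.intro noetherian_module_axioms.intro noetherian_ring)
  show "module R (M\<lparr>carrier := H\<rparr>)" by (rule submodule.submodule_is_module[OF assms module_axioms])
  show "wf {(K, L). submodule L R (M\<lparr>carrier := H\<rparr>) \<and> submodule K R (M\<lparr>carrier := H\<rparr>) \<and> L \<subset> K}"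
    by (rule wf_subset[OF wf_submodules]) (auto simp: submodule_restrict_iff[OF M.abelian_group_axioms assms])
qed

lemma ann_restrict [simp]: "ann R (M\<lparr>carrier := H\<rparr>) x = ann R M x"
  by (simp add: ann_def)

lemma Ass_restrict:
  "Ass R (M\<lparr>carrier := H\<rparr>) = {p. primeideal p R \<and> (\<exists>m\<in>H. ann R M m = p)}"
  by (simp add: Ass_eq)

lemma loc_tors_restrict:
  "H \<subseteq> carrier M \<Longrightarrow> loc_tors R (M\<lparr>carrier := H\<rparr>) p = loc_tors R M p \<inter> H"
  by (auto simp: loc_tors_def)

lemma rank_one_tors_restrict:
  "\<lbrakk>rank_one_tors R M p; H \<subseteq> carrier M\<rbrakk> \<Longrightarrow> rank_one_tors R (M\<lparr>carrier := H\<rparr>) p"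
  by (auto simp: rank_one_tors_def loc_tors_restrict)

context rank_one_module
begin

lemma len_eq: "len R M = (\<Sum>p\<in>Ass R M. {#the_enat (krull_dim (R Quot p))#})"
  unfolding len_def using finlen_at_eq_1_iff rank_one by (intro sum.cong refl) simp

lemma valence_eq: "valence R M = card (Ass R M)"
  by (simp add: valence_def len_eq)

lemma rank_one_submodule:
  assumes "submodule H R M"
  shows "rank_one_module R (M\<lparr>carrier := H\<rparr>)"
proof (intro rank_one_module.intro rank_one_module_axioms.intro noetherian_submodule assms)
  fix p assume "p \<in> Ass R (M\<lparr>carrier := H\<rparr>)"
  then have "p \<in> Ass R M" using submoduleE(1)[OF assms] by (auto simp: Ass_restrict Ass_eq)
  then show "rank_one_tors R (M\<lparr>carrier := H\<rparr>) p"
    by (rule rank_one_tors_restrict[OF rank_one submoduleE(1)[OF assms]])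
qed

text \<open>Equality of lengths is used only through the number of terms, which counts the
  associated primes on either side; a subset of the finite set \<open>Ass R M\<close> with as many
  elements is all of it.\<close>

lemma open_submodule_iff:
  assumes H: "submodule H R M"
  shows "open_submodule R M H \<longleftrightarrow> Ass R (M\<lparr>carrier := H\<rparr>) = Ass R M"
proof
  interpret H: rank_one_module R "M\<lparr>carrier := H\<rparr>" by (rule rank_one_submodule[OF H])
  have sub: "Ass R (M\<lparr>carrier := H\<rparr>) \<subseteq> Ass R M"
    using submoduleE(1)[OF H] by (auto simp: Ass_restrict Ass_eq)
  show "Ass R (M\<lparr>carrier := H\<rparr>) = Ass R M" if "open_submodule R M H"
  proof (rule card_subset_eq[OF finite_Ass sub])
    show "card (Ass R (M\<lparr>carrier := H\<rparr>)) = card (Ass R M)"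
      using that unfolding valence_eq[symmetric] H.valence_eq[symmetric]
      by (simp add: open_submodule_def valence_def)
  qed
  show "open_submodule R M H" if "Ass R (M\<lparr>carrier := H\<rparr>) = Ass R M"
    using that H by (simp add: open_submodule_def len_eq H.len_eq)
qed

lemma loc_null_iff_open:
  assumes f: "f \<in> carrier \<E>"
  shows "f \<in> loc_null R M \<longleftrightarrow> open_submodule R M (a_kernel M M f)"
proof -
  have "f \<in> loc_null R M \<longleftrightarrow> Ass R M \<subseteq> Ass R (M\<lparr>carrier := a_kernel M M f\<rparr>)"
    unfolding loc_null_iff_kernel[OF f] by (auto simp: Ass_restrict Ass_eq a_kernel_def')
  moreover have "Ass R (M\<lparr>carrier := a_kernel M M f\<rparr>) \<subseteq> Ass R M"
    by (auto simp: Ass_restrict Ass_eq a_kernel_def')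
  ultimately show ?thesis unfolding open_submodule_iff[OF submodule_kernel[OF f]] by blast
qed

lemma loc_null_iff_pow:
  assumes f: "f \<in> carrier \<E>"
  shows "f \<in> loc_null R M \<longleftrightarrow> f [^]\<^bsub>\<E>\<^esub> card (Ass R M) = \<zero>\<^bsub>\<E>\<^esub>"
  using nilpotent_imp_loc_null[OF f] pow_in_ideal_power[of f "card (Ass R M)"]
  by (auto simp: ideal_power_loc_null_zero)

end

theorem theorem7p4:
  fixes R :: "('a, 'r) ring_scheme" and M :: "('a, 'b, 'm) module_scheme" and v :: nat
  assumes "cring R" and "noetherian_ring R" and "krull_dim R < \<infinity>"
    and "module R M" and "fg_module R M" and "binary_module R M" and "valence R M = v"
  shows "(\<forall>f \<in> carrier (End_ring R M).
            (nilpotent_elem (End_ring R M) f \<longleftrightarrow> open_submodule R M (a_kernel M M f)) \<and>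
            (open_submodule R M (a_kernel M M f) \<longleftrightarrow>
               f [^]\<^bsub>End_ring R M\<^esub> v = \<zero>\<^bsub>End_ring R M\<^esub>)) \<and>
         ideal (nilpotents (End_ring R M)) (End_ring R M) \<and>
         (no_int_torsion M \<longrightarrow> nilpotent_ideal (End_ring R M) (nilpotents (End_ring R M))) \<and>
         cring (End_ring R M Quot nilpotents (End_ring R M))"
proof -
  interpret noetherian_module R M by (rule module.fg_noetherian_module[OF assms(4,2,5)])
  interpret rank_one_module R M
    using assms(6) finlen_at_eq_1_iff by unfold_locales (simp add: binary_module_def)
  \<comment> \<open>Each associated prime contributes one term to the length, so the valence is the
    exponent found for \<open>loc_null R M\<close>.\<close>
  have v: "v = card (Ass R M)" using assms(7) valence_eq by simp
  have nil: "nilpotent_elem \<E> f \<longleftrightarrow> f \<in> loc_null R M" if "f \<in> carrier \<E>" for f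
    using that nilpotents_eq by (auto simp: nilpotents_def)
  show ?thesis
  proof (intro conjI ballI impI)
    fix f assume f: "f \<in> carrier \<E>"
    show "nilpotent_elem \<E> f \<longleftrightarrow> open_submodule R M (a_kernel M M f)"
      using nil[OF f] loc_null_iff_open[OF f] by simp
    show "open_submodule R M (a_kernel M M f) \<longleftrightarrow> f [^]\<^bsub>\<E>\<^esub> v = \<zero>\<^bsub>\<E>\<^esub>"
      using loc_null_iff_open[OF f] loc_null_iff_pow[OF f] v by simp
  next
    show "ideal (nilpotents \<E>) \<E>" unfolding nilpotents_eq by (rule ideal_loc_null)
    then show "nilpotent_ideal \<E> (nilpotents \<E>)"
      unfolding nilpotent_ideal_def nilpotents_eq using ideal_power_loc_null_zero by blast
    show "cring (\<E> Quot nilpotents \<E>)" by (rule cring_End_Quot)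
  qed
qed

end
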